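(* Let $F_1,\ldots,F_n$ be normed spaces of finite dimensions $d_1,\ldots,d_n$. Then $$d_{BM}\bigl(F_1\otimes_\pi\cdots\otimes_\pi F_n,\;F_1\otimes_\epsilon\cdots\otimes_\epsilon F_n\bigr)\le\prod_{j=1}^{n-1}d_j .$$
   Context: Spaces are over the same field $\mathbb{R}$ or $\mathbb{C}$. $F_1\otimes_\pi\cdots\otimes_\pi F_n$ and $F_1\otimes_\epsilon\cdots\otimes_\epsilon F_n$ denote the tensor product $F_1\otimes\cdots\otimes F_n$ equipped with the projective norm $\pi(z)=\inf\{\sum_i\|x_1^i\|\cdots\|x_n^i\|: z=\sum_i x_1^i\otimes\cdots\otimes x_n^i\}$ and the injective norm $\epsilon(z)=\sup\{|(x_1^*\otimes\cdots\otimes x_n^* )(z)|: x_j^*\in F_j^*,\ \|x_j^*\|\le1\}$, respectively. The Banach-Mazur distance between isomorphic normed spaces is $d_{BM}(X,Y)=\inf\{\|T\|\,\|T^{-1}\|: T:X\to Y \text{ is an onto linear isomorphism}\}$. *)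

theory Defs
  imports "HOL-Analysis.Analysis" "HOL-Library.Function_Algebras"
begin

section \<open>The scalar field\<close>

text \<open>
  The fields isometrically isomorphic to \<open>\<real>\<close> or to \<open>\<complex>\<close>; a type variable of this class stands
  for ``the same field, real or complex''.
\<close>

class real_or_complex_field = real_normed_field +
  assumes real_or_complex:
    "(\<exists>f :: 'a \<Rightarrow> real. bij f \<and> (\<forall>x y. f (x + y) = f x + f y) \<and> (\<forall>r x. f (r *\<^sub>R x) = r *\<^sub>R f x) \<and>
        (\<forall>x y. f (x * y) = f x * f y) \<and> (\<forall>x. norm (f x) = norm x)) \<or>
     (\<exists>f :: 'a \<Rightarrow> complex. bij f \<and> (\<forall>x y. f (x + y) = f x + f y) \<and> (\<forall>r x. f (r *\<^sub>R x) = r *\<^sub>R f x) \<and>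
        (\<forall>x y. f (x * y) = f x * f y) \<and> (\<forall>x. norm (f x) = norm x))"

instance real :: real_or_complex_field
  by standard (rule disjI1, rule exI[of _ id], simp)

instance complex :: real_or_complex_field
  by standard (rule disjI2, rule exI[of _ id], simp)


section \<open>Normed spaces, bounded operators, Banach--Mazur distance\<close>

text \<open>
  A normed space is a subspace \<open>V\<close> of an ambient vector space (the type \<open>'a\<close> with scalar
  multiplication \<open>sc\<close>), together with a norm \<open>N\<close> on \<open>V\<close>; the ambient space itself carries no
  norm. A family of normed spaces over one field is put in this form by embedding it in the
  direct sum of its members.
\<close>

locale normed_space_on = vector_space sc
  for sc :: "'k::real_or_complex_field \<Rightarrow> 'a::ab_group_add \<Rightarrow> 'a" +
  fixes V :: "'a set" and N :: "'a \<Rightarrow> real"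
  assumes subspace: "subspace V"
    and norm_nonneg: "x \<in> V \<Longrightarrow> 0 \<le> N x"
    and norm_eq_zero: "x \<in> V \<Longrightarrow> N x = 0 \<longleftrightarrow> x = 0"
    and norm_scale: "x \<in> V \<Longrightarrow> N (sc c x) = norm c * N x"
    and norm_triangle: "x \<in> V \<Longrightarrow> y \<in> V \<Longrightarrow> N (x + y) \<le> N x + N y"

definition finite_dimensional_on :: "('k::field \<Rightarrow> 'a::ab_group_add \<Rightarrow> 'a) \<Rightarrow> 'a set \<Rightarrow> bool" where
  "finite_dimensional_on sc V \<longleftrightarrow> (\<exists>B. finite B \<and> module.span sc B = V)"

definition linear_map_on ::
  "('k::field \<Rightarrow> 'a::ab_group_add \<Rightarrow> 'a) \<Rightarrow> 'a set \<Rightarrow> ('k \<Rightarrow> 'b::ab_group_add \<Rightarrow> 'b) \<Rightarrow> ('a \<Rightarrow> 'b) \<Rightarrow> bool" where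
  "linear_map_on s1 V s2 T \<longleftrightarrow>
     (\<forall>x\<in>V. \<forall>y\<in>V. T (x + y) = T x + T y) \<and> (\<forall>c. \<forall>x\<in>V. T (s1 c x) = s2 c (T x))"

definition bounded_op :: "'a set \<Rightarrow> ('a \<Rightarrow> real) \<Rightarrow> ('b \<Rightarrow> real) \<Rightarrow> ('a \<Rightarrow> 'b) \<Rightarrow> bool" where
  "bounded_op V N M T \<longleftrightarrow> (\<exists>C. \<forall>x\<in>V. M (T x) \<le> C * N x)"

definition op_norm :: "'a set \<Rightarrow> ('a \<Rightarrow> real) \<Rightarrow> ('b \<Rightarrow> real) \<Rightarrow> ('a \<Rightarrow> 'b) \<Rightarrow> real" where
  "op_norm V N M T = Sup {M (T x) |x. x \<in> V \<and> N x \<le> 1}"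

definition normed_isomorphism ::
  "('k::real_or_complex_field \<Rightarrow> 'a::ab_group_add \<Rightarrow> 'a) \<Rightarrow> 'a set \<Rightarrow> ('a \<Rightarrow> real) \<Rightarrow>
   ('k \<Rightarrow> 'b::ab_group_add \<Rightarrow> 'b) \<Rightarrow> 'b set \<Rightarrow> ('b \<Rightarrow> real) \<Rightarrow> ('a \<Rightarrow> 'b) \<Rightarrow> bool" where
  "normed_isomorphism s1 V N s2 W M T \<longleftrightarrow>
     linear_map_on s1 V s2 T \<and> bij_betw T V W \<and>
     bounded_op V N M T \<and> bounded_op W M N (the_inv_into V T)"

text \<open>
  As the infimum is a real one, the value is meaningful only if there is an isomorphism.
\<close>

definition d_BM ::
  "('k::real_or_complex_field \<Rightarrow> 'a::ab_group_add \<Rightarrow> 'a) \<Rightarrow> 'a set \<Rightarrow> ('a \<Rightarrow> real) \<Rightarrow>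
   ('k \<Rightarrow> 'b::ab_group_add \<Rightarrow> 'b) \<Rightarrow> 'b set \<Rightarrow> ('b \<Rightarrow> real) \<Rightarrow> real" where
  "d_BM s1 V N s2 W M =
     Inf {op_norm V N M T * op_norm W M N (the_inv_into V T) |T. normed_isomorphism s1 V N s2 W M T}"

definition dual_ball ::
  "('k::real_or_complex_field \<Rightarrow> 'a::ab_group_add \<Rightarrow> 'a) \<Rightarrow> 'a set \<Rightarrow> ('a \<Rightarrow> real) \<Rightarrow> ('a \<Rightarrow> 'k) set" where
  "dual_ball sc V N =
     {\<phi>. linear_map_on sc V (*) \<phi> \<and> bounded_op V N norm \<phi> \<and> op_norm V N norm \<phi> \<le> 1}"


section \<open>The algebraic tensor product of finitely many subspaces\<close>

text \<open>
  A family \<open>(x\<^sub>1, \<dots>, x\<^sub>n)\<close> is an element of \<open>\<Pi>\<^sub>E j\<in>{1..n}. F j\<close>. The elementary tensor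
  \<open>x\<^sub>1 \<otimes> \<dots> \<otimes> x\<^sub>n\<close> is evaluation of multilinear forms at that family, and the tensor product is the
  linear span of the elementary tensors, inside the space of scalar functions on forms with the
  pointwise operations. Arguments that are not multilinear forms are sent to \<open>0\<close>, so that
  tensors are determined by their values on multilinear forms. The universal property is
  \<open>tensor_universal\<close> and \<open>tensor_universal_unique\<close> below.
\<close>

definition multilinear_on ::
  "nat \<Rightarrow> ('k::field \<Rightarrow> 'a::ab_group_add \<Rightarrow> 'a) \<Rightarrow> (nat \<Rightarrow> 'a set) \<Rightarrow> ('k \<Rightarrow> 'b::ab_group_add \<Rightarrow> 'b) \<Rightarrow>
   ((nat \<Rightarrow> 'a) \<Rightarrow> 'b) \<Rightarrow> bool" where
  "multilinear_on n sc F s A \<longleftrightarrow>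
     (\<forall>x \<in> (\<Pi>\<^sub>E j\<in>{1..n}. F j). \<forall>j\<in>{1..n}. linear_map_on sc (F j) s (\<lambda>u. A (x(j := u))))"

type_synonym ('k, 'a) tensor = "((nat \<Rightarrow> 'a) \<Rightarrow> 'k) \<Rightarrow> 'k"

definition tensor_scale :: "'k::field \<Rightarrow> ('k, 'a) tensor \<Rightarrow> ('k, 'a) tensor" where
  "tensor_scale c z = (\<lambda>A. c * z A)"

definition elementary_tensor ::
  "nat \<Rightarrow> ('k::field \<Rightarrow> 'a::ab_group_add \<Rightarrow> 'a) \<Rightarrow> (nat \<Rightarrow> 'a set) \<Rightarrow> (nat \<Rightarrow> 'a) \<Rightarrow> ('k, 'a) tensor" where
  "elementary_tensor n sc F x = (\<lambda>A. if multilinear_on n sc F (*) A then A x else 0)"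

definition tensor_space ::
  "nat \<Rightarrow> ('k::field \<Rightarrow> 'a::ab_group_add \<Rightarrow> 'a) \<Rightarrow> (nat \<Rightarrow> 'a set) \<Rightarrow> ('k, 'a) tensor set" where
  "tensor_space n sc F =
     module.span tensor_scale (elementary_tensor n sc F ` (\<Pi>\<^sub>E j\<in>{1..n}. F j))"

lemma vector_space_tensor_scale:
  "vector_space (tensor_scale :: 'k::field \<Rightarrow> ('k, 'a) tensor \<Rightarrow> ('k, 'a) tensor)"
  by unfold_locales (auto simp: tensor_scale_def fun_eq_iff algebra_simps)

lemma vector_space_field: "vector_space ((*) :: 'k::field \<Rightarrow> 'k \<Rightarrow> 'k)"
  by unfold_locales (auto simp: algebra_simps)

lemma multilinear_elementary_tensor:
  "multilinear_on n sc F tensor_scale (elementary_tensor n sc F)"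
proof -
  have *: "linear_map_on sc (F j) tensor_scale (\<lambda>u. elementary_tensor n sc F (x(j := u)))"
    if x: "x \<in> (\<Pi>\<^sub>E j\<in>{1..n}. F j)" and j: "j \<in> {1..n}" for x j
  proof -
    have "linear_map_on sc (F j) (*) (\<lambda>u. A (x(j := u)))" if "multilinear_on n sc F (*) A" for A
      using that x j unfolding multilinear_on_def by blast
    then show ?thesis
      unfolding linear_map_on_def
      by (simp add: elementary_tensor_def tensor_scale_def fun_eq_iff del: fun_upd_apply)
  qed
  show ?thesis unfolding multilinear_on_def using * by blast
qed

lemma tensor_universal:
  fixes sc :: "'k::field \<Rightarrow> 'a::ab_group_add \<Rightarrow> 'a" and s :: "'k \<Rightarrow> 'b::ab_group_add \<Rightarrow> 'b"
  assumes s: "vector_space s" and B: "multilinear_on n sc F s B"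
  shows "\<exists>T. linear_map_on tensor_scale (tensor_space n sc F) s T \<and>
             (\<forall>x \<in> (\<Pi>\<^sub>E j\<in>{1..n}. F j). T (elementary_tensor n sc F x) = B x)"
proof -
  define P where "P = (\<Pi>\<^sub>E j\<in>{1..n}. F j)"
  define e where "e = elementary_tensor n sc F"
  interpret ts: vector_space "tensor_scale :: 'k \<Rightarrow> ('k, 'a) tensor \<Rightarrow> ('k, 'a) tensor"
    by (rule vector_space_tensor_scale)
  interpret w: vector_space s by (rule s)
  interpret tw: vector_space_pair "tensor_scale :: 'k \<Rightarrow> ('k, 'a) tensor \<Rightarrow> ('k, 'a) tensor" s
    by unfold_locales
  interpret k: vector_space "(*) :: 'k \<Rightarrow> 'k \<Rightarrow> 'k" by (rule vector_space_field)
  interpret wk: vector_space_pair s "(*) :: 'k \<Rightarrow> 'k \<Rightarrow> 'k" by unfold_locales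
  interpret tk: vector_space_pair "tensor_scale :: 'k \<Rightarrow> ('k, 'a) tensor \<Rightarrow> ('k, 'a) tensor"
    "(*) :: 'k \<Rightarrow> 'k \<Rightarrow> 'k" by unfold_locales
  obtain S where S: "S \<subseteq> e ` P" "ts.independent S" "e ` P \<subseteq> ts.span S"
    by (rule ts.maximal_independent_subset)
  define g where "g = inv_into P e"
  have g: "g v \<in> P \<and> e (g v) = v" if "v \<in> S" for v
    using S(1) that unfolding g_def by (simp add: subsetD inv_into_into f_inv_into_f)
  obtain T where T: "Vector_Spaces.linear tensor_scale s T" "\<forall>v\<in>S. T v = B (g v)"
    using tw.linear_independent_extend[OF S(2), of "\<lambda>v. B (g v)"] by blast
  have T_e: "T (e x) = B x" if x: "x \<in> P" for x
  proof (rule ccontr)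
    assume neq: "T (e x) \<noteq> B x"
    define u where "u = B x - T (e x)"
    have "w.independent {u}" using neq by (simp add: u_def w.dependent_single)
    then obtain f where f: "Vector_Spaces.linear s (*) f" "\<forall>v\<in>{u}. f v = 1"
      using wk.linear_independent_extend[of "{u}" "\<lambda>_. 1"] by blast
    interpret f: Vector_Spaces.linear s "(*)" f by (rule f(1))
    interpret T: Vector_Spaces.linear tensor_scale s T by (rule T(1))
    have ml: "multilinear_on n sc F (*) (\<lambda>y. f (B y))"
      using B by (simp add: multilinear_on_def linear_map_on_def f.add f.scale)
    have lin_ev: "Vector_Spaces.linear tensor_scale (*) (\<lambda>z :: ('k, 'a) tensor. z (\<lambda>y. f (B y)))"
      by unfold_locales (auto simp: tensor_scale_def)
    have lin_fT: "Vector_Spaces.linear tensor_scale (*) (\<lambda>z. f (T z))"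
      by unfold_locales (auto simp: T.add T.scale f.add f.scale)
    have "f (T (e x)) = e x (\<lambda>y. f (B y))"
    proof (rule tk.linear_eq_on[OF lin_fT lin_ev])
      show "e x \<in> ts.span S" using S(3) x by (meson imageI subsetD)
    next
      fix v assume v: "v \<in> S"
      then have "v (\<lambda>y. f (B y)) = e (g v) (\<lambda>y. f (B y))" using g by simp
      also have "\<dots> = f (B (g v))" using ml by (simp add: e_def elementary_tensor_def)
      finally show "f (T v) = v (\<lambda>y. f (B y))" using T(2) v by simp
    qed
    also have "\<dots> = f (B x)" using ml by (simp add: e_def elementary_tensor_def)
    finally have "f u = 0" by (simp add: u_def f.diff)
    then show False using f(2) by simp
  qed
  interpret T: Vector_Spaces.linear tensor_scale s T by (rule T(1))
  have "linear_map_on tensor_scale (tensor_space n sc F) s T"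
    by (simp add: linear_map_on_def T.add T.scale)
  with T_e show "\<exists>T. linear_map_on tensor_scale (tensor_space n sc F) s T \<and>
             (\<forall>x \<in> (\<Pi>\<^sub>E j\<in>{1..n}. F j). T (elementary_tensor n sc F x) = B x)"
    unfolding P_def e_def by blast
qed

lemma tensor_universal_unique:
  fixes sc :: "'k::field \<Rightarrow> 'a::ab_group_add \<Rightarrow> 'a" and s :: "'k \<Rightarrow> 'b::ab_group_add \<Rightarrow> 'b"
  assumes s: "vector_space s"
    and lin: "linear_map_on tensor_scale (tensor_space n sc F) s T"
      "linear_map_on tensor_scale (tensor_space n sc F) s T'"
    and eq: "\<And>x. x \<in> (\<Pi>\<^sub>E j\<in>{1..n}. F j) \<Longrightarrow>
      T (elementary_tensor n sc F x) = T' (elementary_tensor n sc F x)"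
    and z: "z \<in> tensor_space n sc F"
  shows "T z = T' z"
proof -
  interpret ts: vector_space "tensor_scale :: 'k \<Rightarrow> ('k, 'a) tensor \<Rightarrow> ('k, 'a) tensor"
    by (rule vector_space_tensor_scale)
  interpret w: vector_space s by (rule s)
  define W where "W = tensor_space n sc F"
  have W: "ts.subspace W" by (simp add: W_def tensor_space_def)
  have zero: "R 0 = 0" if "linear_map_on tensor_scale W s R" for R
  proof -
    have "R (tensor_scale 0 0) = s 0 (R 0)"
      using that ts.subspace_0[OF W] unfolding linear_map_on_def by blast
    then show ?thesis by simp
  qed
  have "ts.subspace {z \<in> W. T z = T' z}"
  proof (rule ts.subspaceI)
    show "0 \<in> {z \<in> W. T z = T' z}"
      using zero[OF lin(1)[folded W_def]] zero[OF lin(2)[folded W_def]] ts.subspace_0[OF W] by simp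
  next
    fix x y assume "x \<in> {z \<in> W. T z = T' z}" "y \<in> {z \<in> W. T z = T' z}"
    then show "x + y \<in> {z \<in> W. T z = T' z}"
      using lin ts.subspace_add[OF W] by (simp add: linear_map_on_def W_def)
  next
    fix c x assume "x \<in> {z \<in> W. T z = T' z}"
    then show "tensor_scale c x \<in> {z \<in> W. T z = T' z}"
      using lin ts.subspace_scale[OF W] by (simp add: linear_map_on_def W_def)
  qed
  then have "ts.span (elementary_tensor n sc F ` (\<Pi>\<^sub>E j\<in>{1..n}. F j)) \<subseteq> {z \<in> W. T z = T' z}"
    by (rule ts.span_minimal[rotated]) (use eq in \<open>auto simp: W_def tensor_space_def intro: ts.span_base\<close>)
  then show ?thesis using z by (auto simp: tensor_space_def)
qed


section \<open>Projective and injective norms\<close>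

definition projective_norm ::
  "nat \<Rightarrow> ('k::real_or_complex_field \<Rightarrow> 'a::ab_group_add \<Rightarrow> 'a) \<Rightarrow> (nat \<Rightarrow> 'a set) \<Rightarrow> (nat \<Rightarrow> 'a \<Rightarrow> real) \<Rightarrow>
   ('k, 'a) tensor \<Rightarrow> real" where
  "projective_norm n sc F N z =
     Inf {\<Sum>i<m. \<Prod>j=1..n. N j (x i j) | (m::nat) x.
            (\<forall>i<m. x i \<in> (\<Pi>\<^sub>E j\<in>{1..n}. F j)) \<and> z = (\<Sum>i<m. elementary_tensor n sc F (x i))}"

text \<open>
  The functional \<open>x\<^sub>1\<^sup>* \<otimes> \<dots> \<otimes> x\<^sub>n\<^sup>*\<close> on the tensor product: the value of a tensor at the multilinear
  form \<open>(x\<^sub>1, \<dots>, x\<^sub>n) \<mapsto> x\<^sub>1\<^sup>*(x\<^sub>1) \<cdots> x\<^sub>n\<^sup>*(x\<^sub>n)\<close>.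
\<close>

definition tensor_functional :: "nat \<Rightarrow> (nat \<Rightarrow> 'a \<Rightarrow> 'k::field) \<Rightarrow> ('k, 'a) tensor \<Rightarrow> 'k" where
  "tensor_functional n \<phi> z = z (\<lambda>x. \<Prod>j=1..n. \<phi> j (x j))"

lemma multilinear_prod_functionals:
  assumes "\<And>j. j \<in> {1..n} \<Longrightarrow> linear_map_on sc (F j) (*) (\<phi> j)"
  shows "multilinear_on n sc F (*) (\<lambda>x. \<Prod>j=1..n. \<phi> j (x j))"
proof -
  have "(\<Prod>i=1..n. \<phi> i ((x(j := u)) i)) = \<phi> j u * (\<Prod>i\<in>{1..n} - {j}. \<phi> i (x i))"
    if "j \<in> {1..n}" for x j u
  proof -
    have "(\<Prod>i=1..n. \<phi> i ((x(j := u)) i)) = \<phi> j u * (\<Prod>i\<in>{1..n} - {j}. \<phi> i ((x(j := u)) i))"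
      using that by (subst prod.remove[of _ j]) auto
    also have "(\<Prod>i\<in>{1..n} - {j}. \<phi> i ((x(j := u)) i)) = (\<Prod>i\<in>{1..n} - {j}. \<phi> i (x i))"
      by (rule prod.cong) auto
    finally show ?thesis .
  qed
  then show ?thesis
    using assms unfolding multilinear_on_def linear_map_on_def
    by (simp add: distrib_right mult.assoc del: fun_upd_apply)
qed

lemma tensor_functional_elementary:
  assumes "\<And>j. j \<in> {1..n} \<Longrightarrow> linear_map_on sc (F j) (*) (\<phi> j)"
  shows "tensor_functional n \<phi> (elementary_tensor n sc F x) = (\<Prod>j=1..n. \<phi> j (x j))"
  using multilinear_prod_functionals[of n sc F \<phi>] assms
  by (simp add: tensor_functional_def elementary_tensor_def)

definition injective_norm ::
  "nat \<Rightarrow> ('k::real_or_complex_field \<Rightarrow> 'a::ab_group_add \<Rightarrow> 'a) \<Rightarrow> (nat \<Rightarrow> 'a set) \<Rightarrow> (nat \<Rightarrow> 'a \<Rightarrow> real) \<Rightarrow>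
   ('k, 'a) tensor \<Rightarrow> real" where
  "injective_norm n sc F N z =
     Sup {norm (tensor_functional n \<phi> z) |\<phi>. \<forall>j\<in>{1..n}. \<phi> j \<in> dual_ball sc (F j) (N j)}"

end

theory Submission
  imports Defs "Jordan_Normal_Form.Determinant"
begin

text \<open>
  The identity has norm at most \<open>1\<close> from the projective to the injective norm. Conversely, take for
  each \<open>j < n\<close> an Auerbach basis \<open>e\<^sub>1, \<dots>, e\<^sub>d\<close> of \<open>F\<^sub>j\<close>, that is, vectors and
  coordinate functionals in the respective unit balls (up to a factor \<open>t \<rightarrow> 1\<close>). Expanding a tensor \<open>z\<close> in the first \<open>n - 1\<close>
  factors writes it as a sum of \<open>d\<^sub>1 \<cdots> d\<^bsub>n-1\<^esub>\<close> elementary tensors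
  \<open>e\<^sub>k \<otimes> \<dots> \<otimes> e\<^sub>l \<otimes> w\<close>, and each \<open>w\<close> has norm at most \<open>\<epsilon>(z)\<close>, as one sees by applying
  coordinate functionals to \<open>z\<close> together with a functional on \<open>F\<^sub>n\<close> that norms \<open>w\<close>.
\<close>

section \<open>Real and complex scalars\<close>

text \<open>An isometric isomorphism with the reals or the complex numbers is turned into intrinsic
  data of \<open>'k\<close>: every scalar is real, or there is a square root \<open>\<iota>\<close>
  of -1 with the usual coordinates and norm. Later arguments then never leave
  \<open>'k\<close>.\<close>

lemma scalar_cases:
  obtains (real) "\<And>c :: 'k::real_or_complex_field. \<exists>r. c = of_real r"
  | (complex) \<iota> :: "'k::real_or_complex_field" where "\<iota> * \<iota> = -1" "\<And>c :: 'k::real_or_complex_field. \<exists>a b. c = of_real a + of_real b * \<iota>"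
      "\<And>a b. norm (of_real a + of_real b * \<iota>) = sqrt (a\<^sup>2 + b\<^sup>2)"
proof -
  consider f :: "'k \<Rightarrow> real" where "bij f" "\<And>x y. f (x + y) = f x + f y" "\<And>r x. f (r *\<^sub>R x) = r *\<^sub>R f x"
      "\<And>x y. f (x * y) = f x * f y" "\<And>x. norm (f x) = norm x"
    | f :: "'k \<Rightarrow> complex" where "bij f" "\<And>x y. f (x + y) = f x + f y" "\<And>r x. f (r *\<^sub>R x) = r *\<^sub>R f x"
      "\<And>x y. f (x * y) = f x * f y" "\<And>x. norm (f x) = norm x"
    using real_or_complex[where 'a='k] by blast
  then show thesis
  proof cases
    case (1 f)
    \<comment> \<open>The image of 1 is idempotent, and nonzero because \<open>f\<close> is
      isometric; hence it is 1, and \<open>f\<close> commutes with \<open>of_real\<close>.\<close>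
    have "f 1 * f 1 = f 1" using 1(4)[of 1 1] by simp
    moreover have "f 1 \<noteq> 0" using 1(5)[of 1] by auto
    ultimately have one: "f 1 = 1" by simp
    have "c = of_real (f c)" for c :: 'k
    proof -
      have "f (of_real (f c)) = f c" by (simp add: of_real_def 1(3) one)
      then show ?thesis using 1(1) by (metis bij_pointE)
    qed
    then show thesis using real by blast
  next
    case (2 f)
    have "f 1 * f 1 = f 1" using 2(4)[of 1 1] by simp
    moreover have "f 1 \<noteq> 0" using 2(5)[of 1] by auto
    ultimately have one: "f 1 = 1" by simp
    have of_real: "f (of_real r) = of_real r" for r
      by (simp add: of_real_def 2(3) one)
    have inj: "x = y" if "f x = f y" for x y using that 2(1) by (metis bij_pointE)
    obtain \<iota> where \<iota>: "f \<iota> = \<i>" using 2(1) by (metis bij_pointE)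
    have f: "f (of_real a + of_real b * \<iota>) = Complex a b" for a b
      by (simp add: 2(2,4) of_real \<iota> complex_eq_iff)
    have "f (\<iota> * \<iota> + 1) = f 0"
      using 2(2)[of 0 0] by (simp add: 2(2,4) \<iota> one)
    then have "\<iota> * \<iota> = -1" using inj by (metis add_eq_0_iff2)
    moreover have "\<exists>a b. c = of_real a + of_real b * \<iota>" for c
      using f inj by (metis complex.collapse)
    moreover have "norm (of_real a + of_real b * \<iota>) = sqrt (a\<^sup>2 + b\<^sup>2)" for a b
      using 2(5)[of "of_real a + of_real b * \<iota>"] by (simp add: f cmod_def)
    ultimately show thesis using complex by blast
  qed
qed

text \<open>Homogeneity concerns real factors only, also over complex scalars: the Hahn-Banach
  argument takes place in the underlying real space. Real linearity is later recognized by the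
  symmetry \<open>q (- x) = - q x\<close>.\<close>

definition real_sublinear_on ::
  "('k::real_normed_field \<Rightarrow> 'a::ab_group_add \<Rightarrow> 'a) \<Rightarrow> 'a set \<Rightarrow> ('a \<Rightarrow> real) \<Rightarrow> bool" where
  "real_sublinear_on sc V q \<longleftrightarrow>
     (\<forall>x\<in>V. \<forall>y\<in>V. q (x + y) \<le> q x + q y) \<and>
     (\<forall>r\<ge>0. \<forall>x\<in>V. q (sc (of_real r) x) = r * q x)"

lemma linear_map_on_zero:
  assumes "vector_space s1" "vector_space s2" "linear_map_on s1 V s2 T" "0 \<in> V"
  shows "T 0 = 0"
proof -
  interpret s1: vector_space s1 by fact
  interpret s2: vector_space s2 by fact
  have "T (s1 0 0) = s2 0 (T 0)" using assms(3,4) unfolding linear_map_on_def by blast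
  then show ?thesis by simp
qed

section \<open>Determinants\<close>

text \<open>Each term of the Leibniz formula has norm at most 1. The crude bound suffices, since it
  only serves to make a supremum of determinants finite.\<close>

lemma norm_det_le_card_permutations:
  fixes A :: "'k::real_normed_field mat"
  assumes A: "A \<in> carrier_mat n n" and le: "\<And>i j. i < n \<Longrightarrow> j < n \<Longrightarrow> norm (A $$ (i, j)) \<le> 1"
  shows "norm (Determinant.det A) \<le> real (card {p. p permutes {0..<n}})"
proof -
  have "norm (Determinant.det A) \<le> (\<Sum>p | p permutes {0..<n}. norm (signof p * (\<Prod>i = 0..<n. A $$ (i, p i))))"
    unfolding det_def'[OF A] by (rule norm_sum)
  also have "\<dots> \<le> (\<Sum>p | p permutes {0..<n}. 1)"
  proof (rule sum_mono)
    fix p assume "p \<in> {p. p permutes {0..<n}}"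
    then have p: "p permutes {0..<n}" by simp
    have "(\<Prod>i = 0..<n. norm (A $$ (i, p i))) \<le> 1"
      using permutes_in_image[OF p] by (intro prod_le_1) (auto intro: le)
    then show "norm (signof p * (\<Prod>i = 0..<n. A $$ (i, p i))) \<le> 1"
      by (simp add: norm_mult prod_norm sign_def)
  qed
  finally show ?thesis by simp
qed

text \<open>In the Laplace expansion along row \<open>i\<close> the cofactors do not involve that
  row, so they are the same for all \<open>y\<close>. Thus the determinant inherits linearity in
  \<open>y\<close> from the \<open>g j\<close>.\<close>

lemma det_replace_row:
  fixes g :: "nat \<Rightarrow> 'b \<Rightarrow> 'k::comm_ring_1"
  assumes i: "i < n"
  shows "\<exists>c. \<forall>y. Determinant.det (mat n n (\<lambda>(k, j). g j ((x(i := y)) k))) = (\<Sum>j<n. g j y * c j)"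
proof -
  define M where "M y = mat n n (\<lambda>(k, j). g j ((x(i := y)) k))" for y
  define c where "c j = cofactor (M (x i)) i j" for j
  have "mat_delete (M y) i j = mat_delete (M (x i)) i j" for y j
    by (rule eq_matI) (auto simp: mat_delete_def M_def)
  then have cof: "cofactor (M y) i j = c j" for y j
    unfolding cofactor_def c_def by metis
  have "Determinant.det (M y) = (\<Sum>j<n. g j y * c j)" for y
  proof -
    have "Determinant.det (M y) = (\<Sum>j<n. M y $$ (i, j) * cofactor (M y) i j)"
      using i by (intro laplace_expansion_row) (simp_all add: M_def)
    also have "\<dots> = (\<Sum>j<n. g j y * c j)"
      using i by (intro sum.cong) (auto simp: cof, simp add: M_def)
    finally show ?thesis .
  qed
  then show ?thesis unfolding M_def by blast
qed

section \<open>Symmetrization of sublinear functionals\<close>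

context normed_space_on
begin

text \<open>One step of the Hahn-Banach theorem through minimal sublinear functionals:
  \<open>q' x\<close> is the infimum over \<open>t >= 0\<close> of
  \<open>q (x + t b) - t q b\<close>. The choices \<open>t = 0\<close> at \<open>x\<close> and
  \<open>t = 1\<close> at \<open>- b\<close> give the two inequalities.\<close>

lemma real_sublinear_symmetrize:
  assumes q: "real_sublinear_on sc V q" and b: "b \<in> V"
  shows "\<exists>q'. real_sublinear_on sc V q' \<and> (\<forall>x\<in>V. q' x \<le> q x) \<and> q' (- b) \<le> - q b"
proof -
  have add: "q (x + y) \<le> q x + q y" if "x \<in> V" "y \<in> V" for x y
    using q that by (simp add: real_sublinear_on_def)
  have hom: "q (sc (of_real r) x) = r * q x" if "0 \<le> r" "x \<in> V" for r x
    using q that by (simp add: real_sublinear_on_def)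
  note V [simp] = subspace_add[OF subspace] subspace_scale[OF subspace] subspace_neg[OF subspace]
  define A where "A x = (\<lambda>t. q (x + sc (of_real t) b) - t * q b) ` {0..}" for x
  define q' where "q' x = Inf (A x)" for x
  have ne: "A x \<noteq> {}" for x by (auto simp: A_def)
  \<comment> \<open>As \<open>t b\<close> is the sum of \<open>x + t b\<close> and
    \<open>- x\<close>, subadditivity gives a lower bound independent of \<open>t\<close>, so that
    the infimum is a genuine one.\<close>
  have lb: "- q (- x) \<le> q (x + sc (of_real t) b) - t * q b" if "0 \<le> t" "x \<in> V" for x t
    using add[of "x + sc (of_real t) b" "- x"] that b by (simp add: hom)
  have bdd: "bdd_below (A x)" if "x \<in> V" for x
    unfolding A_def using lb that by (intro bdd_belowI2[of _ "- q (- x)"]) auto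
  have le: "q' x \<le> q (x + sc (of_real t) b) - t * q b" if "0 \<le> t" "x \<in> V" for x t
    unfolding q'_def using that by (intro cInf_lower bdd) (auto simp: A_def)
  have ge: "m \<le> q' x" if "\<And>t. 0 \<le> t \<Longrightarrow> m \<le> q (x + sc (of_real t) b) - t * q b" for m x
    unfolding q'_def using that by (intro cInf_greatest ne) (auto simp: A_def)
  have zero: "q 0 = 0" using hom[of 0 b] b by simp
  have "q' (x + y) \<le> q' x + q' y" if xy: "x \<in> V" "y \<in> V" for x y
  proof -
    have *: "q' (x + y) \<le> (q (x + sc (of_real s) b) - s * q b) + (q (y + sc (of_real t) b) - t * q b)"
      if "0 \<le> s" "0 \<le> t" for s t
    proof -
      have "q' (x + y) \<le> q ((x + y) + sc (of_real (s + t)) b) - (s + t) * q b"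
        using that xy by (intro le) auto
      also have "(x + y) + sc (of_real (s + t)) b = (x + sc (of_real s) b) + (y + sc (of_real t) b)"
        by (simp add: scale_left_distrib algebra_simps)
      also have "q \<dots> \<le> q (x + sc (of_real s) b) + q (y + sc (of_real t) b)"
        using xy b by (intro add) auto
      finally show ?thesis by (simp add: algebra_simps)
    qed
    \<comment> \<open>The parameters \<open>s\<close> and \<open>t\<close> are independent, so the
      two infima are taken one after the other.\<close>
    have "q' (x + y) - (q (x + sc (of_real s) b) - s * q b) \<le> q' y" if "0 \<le> s" for s
      using *[OF that] by (intro ge) (simp add: algebra_simps)
    then have "q' (x + y) - q' y \<le> q' x" by (intro ge) (simp add: algebra_simps)
    then show ?thesis by simp
  qed
  moreover have "q' (sc (of_real r) x) = r * q' x" if r: "0 \<le> r" and x: "x \<in> V" for r x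
  proof (cases "r = 0")
    case True
    have "q' 0 = 0"
      using le[of 0 0] b subspace_0[OF subspace] by (intro antisym ge) (auto simp: hom zero)
    then show ?thesis using True by simp
  next
    case False
    with r have r: "0 < r" by simp
    \<comment> \<open>For \<open>r > 0\<close> the substitution of \<open>r t\<close> for
      \<open>t\<close> maps the nonnegative reals onto themselves; it is used in both
      directions.\<close>
    have scale: "q (sc (of_real r) x + sc (of_real (r * t)) b) - (r * t) * q b =
        r * (q (x + sc (of_real t) b) - t * q b)" for t
    proof -
      have "sc (of_real r) x + sc (of_real (r * t)) b = sc (of_real r) (x + sc (of_real t) b)"
        by (simp add: scale_right_distrib)
      then show ?thesis using hom[of r "x + sc (of_real t) b"] r x b
        by (simp only: V) (simp add: algebra_simps)
    qed
    have "q' (sc (of_real r) x) / r \<le> q' x"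
    proof (rule ge)
      fix t :: real assume "0 \<le> t"
      then show "q' (sc (of_real r) x) / r \<le> q (x + sc (of_real t) b) - t * q b"
        using le[of "r * t" "sc (of_real r) x"] r x scale[of t] by (simp add: field_simps)
    qed
    moreover have "r * q' x \<le> q' (sc (of_real r) x)"
    proof (rule ge)
      fix t :: real assume "0 \<le> t"
      then have "q' x \<le> q (x + sc (of_real (t / r)) b) - (t / r) * q b"
        using r x by (intro le) auto
      then have "r * q' x \<le> r * (q (x + sc (of_real (t / r)) b) - (t / r) * q b)"
        using r by simp
      then show "r * q' x \<le> q (sc (of_real r) x + sc (of_real t) b) - t * q b"
        using scale[of "t / r"] r by simp
    qed
    ultimately show ?thesis using r by (simp add: field_simps)
  qed
  moreover have "q' x \<le> q x" if "x \<in> V" for x using le[of 0 x] that by simp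
  moreover have "q' (- b) \<le> - q b" using le[of 1 "- b"] b zero by simp
  ultimately show ?thesis unfolding real_sublinear_on_def by blast
qed

text \<open>The vectors of \<open>B\<close> are treated one by one. Symmetry gained at an earlier
  vector survives the passage to a smaller sublinear functional.\<close>

lemma real_sublinear_symmetrize_finite:
  assumes "finite B" "B \<subseteq> V" "real_sublinear_on sc V q"
  shows "\<exists>q'. real_sublinear_on sc V q' \<and> (\<forall>x\<in>V. q' x \<le> q x) \<and> (\<forall>b\<in>B. q' (- b) = - q' b)"
  using assms
proof (induction B rule: finite_induct)
  case empty
  then show ?case by (auto intro!: exI[of _ q])
next
  case (insert b B)
  then obtain q1 where q1: "real_sublinear_on sc V q1" "\<forall>x\<in>V. q1 x \<le> q x" "\<forall>b\<in>B. q1 (- b) = - q1 b"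
    by auto
  obtain q2 where q2: "real_sublinear_on sc V q2" "\<forall>x\<in>V. q2 x \<le> q1 x" "q2 (- b) \<le> - q1 b"
    using real_sublinear_symmetrize[OF q1(1)] insert by blast
  \<comment> \<open>From \<open>q2 <= q1\<close> follows
    \<open>q2 (- c) <= - q1 c <= - q2 c\<close>; the reverse inequality is
    \<open>0 = q2 0 <= q2 c + q2 (- c)\<close>.\<close>
  have "q2 (- c) = - q2 c" if c: "c \<in> V" "q2 (- c) \<le> - q1 c" for c
  proof -
    have "q2 (c + - c) \<le> q2 c + q2 (- c)"
      using q2(1) c subspace_neg[OF subspace] by (simp only: real_sublinear_on_def)
    moreover have "q2 (sc (of_real 0) c) = 0 * q2 c"
      using q2(1) c unfolding real_sublinear_on_def by blast
    ultimately show ?thesis using q2(2) c by fastforce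
  qed
  moreover have "q2 (- c) \<le> - q1 c" if "c \<in> insert b B" for c
    using that q1(3) q2(2,3) insert.prems(1) subspace_neg[OF subspace] by fastforce
  ultimately have "\<forall>c\<in>insert b B. q2 (- c) = - q2 c"
    using insert.prems(1) by blast
  then show ?case using q1(2) q2(1,2) by (meson order_trans)
qed

lemma real_sublinear_norm: "real_sublinear_on sc V N"
  by (simp add: real_sublinear_on_def norm_triangle norm_scale)

text \<open>Subadditivity pinches the values:
  \<open>- q (x + y) <= q (- (x + y)) <= - q x - q y <= - q (x + y)\<close>. With
  \<open>symmetric_scale\<close>, the symmetric vectors form a real subspace on which
  \<open>q\<close> is real linear.\<close>

lemma symmetric_add:
  assumes q: "real_sublinear_on sc V q" and xy: "x \<in> V" "y \<in> V"
    and s: "q (- x) = - q x" "q (- y) = - q y"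
  shows "q (x + y) = q x + q y" "q (- (x + y)) = - q (x + y)"
proof -
  note V [simp] = subspace_add[OF subspace] subspace_scale[OF subspace] subspace_neg[OF subspace]
  have add: "q (u + w) \<le> q u + q w" if "u \<in> V" "w \<in> V" for u w
    using q that by (simp add: real_sublinear_on_def)
  have "q (sc (of_real 0) x) = 0 * q x"
    using q xy unfolding real_sublinear_on_def by blast
  then have "0 \<le> q (x + y) + q (- (x + y))" using add[of "x + y" "- (x + y)"] xy V(3)[of "x + y"] by simp
  moreover have "q (- (x + y)) \<le> - q x - q y" using add[of "- x" "- y"] xy s by simp
  moreover note add[OF xy]
  ultimately show "q (x + y) = q x + q y" "q (- (x + y)) = - q (x + y)" by auto
qed

lemma symmetric_scale:
  assumes q: "real_sublinear_on sc V q" and x: "x \<in> V" and s: "q (- x) = - q x"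
  shows "q (sc (of_real r) x) = r * q x" "q (- sc (of_real r) x) = - q (sc (of_real r) x)"
proof -
  have hom: "q (sc (of_real t) u) = t * q u" if "0 \<le> t" "u \<in> V" for t u
    using q that by (simp add: real_sublinear_on_def)
  have "q (sc (of_real r) x) = r * q x \<and> q (- sc (of_real r) x) = - (r * q x)"
  proof (cases "0 \<le> r")
    case True
    have "sc (of_real r) (- x) = - sc (of_real r) x" by simp
    then show ?thesis using hom[of r x] hom[of r "- x"] True x s subspace_neg[OF subspace x]
      by (metis mult_minus_right)
  next
    case False
    have "sc (of_real (- r)) (- x) = sc (of_real r) x" "sc (of_real (- r)) x = - sc (of_real r) x"
      by simp_all
    then show ?thesis
      using hom[of "- r" x] hom[of "- r" "- x"] False x s subspace_neg[OF subspace x]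
      by (simp del: of_real_minus)
  qed
  then show "q (sc (of_real r) x) = r * q x" "q (- sc (of_real r) x) = - q (sc (of_real r) x)"
    by auto
qed

text \<open>The span is taken over \<open>'k\<close>, whereas \<open>symmetric_scale\<close> handles
  real factors only; this is why symmetry is assumed at all scalar multiples of the vectors in
  \<open>B\<close>.\<close>

lemma symmetric_on_span:
  assumes q: "real_sublinear_on sc V q" and B: "B \<subseteq> V"
    and s: "\<And>b c. b \<in> B \<Longrightarrow> q (- sc c b) = - q (sc c b)"
    and x: "x \<in> span B"
  shows "q (- x) = - q x"
proof -
  have "x \<in> V \<and> q (- x) = - q x"
    using x
  proof (induction rule: span_induct_alt)
    case base
    have "q (sc (of_real 0) 0) = 0 * q 0"
      using q subspace_0[OF subspace] unfolding real_sublinear_on_def by blast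
    then show ?case using subspace_0[OF subspace] by simp
  next
    case (step c b y)
    then show ?case
      using symmetric_add(2)[OF q, of "sc c b" y] s B subspace_add[OF subspace] subspace_scale[OF subspace]
      by blast
  qed
  then show ?thesis by simp
qed

section \<open>The dual unit ball and norming functionals\<close>

lemma bounded_functional_in_dual_ball:
  assumes "linear_map_on sc V (*) \<phi>" "\<And>x. x \<in> V \<Longrightarrow> norm (\<phi> x) \<le> N x"
  shows "\<phi> \<in> dual_ball sc V N"
proof -
  have "op_norm V N norm \<phi> \<le> 1"
    unfolding op_norm_def
  proof (rule cSup_least)
    show "{norm (\<phi> x) |x. x \<in> V \<and> N x \<le> 1} \<noteq> {}"
      using subspace_0[OF subspace] norm_eq_zero[of 0] by fastforce
  qed (use assms(2) in force)
  moreover have "bounded_op V N norm \<phi>"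
    unfolding bounded_op_def using assms(2) by (intro exI[of _ 1]) auto
  ultimately show ?thesis using assms(1) by (simp add: dual_ball_def)
qed

lemma dual_ball_linear: "\<phi> \<in> dual_ball sc V N \<Longrightarrow> linear_map_on sc V (*) \<phi>"
  by (simp add: dual_ball_def)

lemma norm_normalize: "x \<in> V \<Longrightarrow> x \<noteq> 0 \<Longrightarrow> N (sc (of_real (1 / N x)) x) = 1"
  using norm_nonneg[of x] norm_eq_zero[of x] by (simp add: norm_scale norm_divide)

lemma dual_ball_bound:
  assumes \<phi>: "\<phi> \<in> dual_ball sc V N" and x: "x \<in> V"
  shows "norm (\<phi> x) \<le> N x"
proof (cases "x = 0")
  case True
  have "\<phi> (sc 0 x) = 0 * \<phi> x"
    using dual_ball_linear[OF \<phi>] x unfolding linear_map_on_def by blast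
  then show ?thesis using True norm_nonneg[OF x] by simp
next
  case False
  let ?S = "{norm (\<phi> x) |x. x \<in> V \<and> N x \<le> 1}"
  obtain C where C: "\<forall>x\<in>V. norm (\<phi> x) \<le> C * N x"
    using \<phi> by (auto simp: dual_ball_def bounded_op_def)
  \<comment> \<open>A real supremum bounds its set only if the set is bounded above; this is what
    \<open>bounded_op\<close> in \<open>dual_ball\<close> provides.\<close>
  have "bdd_above ?S"
  proof (rule bdd_aboveI)
    fix y assume "y \<in> ?S"
    then obtain u where u: "u \<in> V" "N u \<le> 1" "y = norm (\<phi> u)" by blast
    have "norm (\<phi> u) \<le> C * N u" using C u by blast
    also have "\<dots> \<le> \<bar>C\<bar> * 1" using u norm_nonneg[of u] by (intro mult_mono) auto
    finally show "y \<le> \<bar>C\<bar>" using u by simp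
  qed
  moreover have "norm (\<phi> (sc (of_real (1 / N x)) x)) \<in> ?S"
    using norm_normalize[OF x False] subspace_scale[OF subspace x] by force
  ultimately have "norm (\<phi> (sc (of_real (1 / N x)) x)) \<le> op_norm V N norm \<phi>"
    unfolding op_norm_def by (rule cSup_upper[rotated])
  also have "\<dots> \<le> 1" using \<phi> by (simp add: dual_ball_def)
  also have "\<phi> (sc (of_real (1 / N x)) x) = of_real (1 / N x) * \<phi> x"
    using dual_ball_linear[OF \<phi>] x unfolding linear_map_on_def by blast
  finally have "norm (of_real (1 / N x) * \<phi> x) \<le> 1" .
  moreover have "0 < N x" using norm_nonneg[OF x] norm_eq_zero[OF x] False by linarith
  ultimately show ?thesis by (simp add: norm_mult norm_divide pos_divide_le_eq)
qed

text \<open>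
  A minimal sublinear functional below the norm is real linear; minimality is only needed along
  a real spanning set. In the complex case the real linear \<open>q\<close> is complexified as
  \<open>x \<mapsto> q x - \<iota> q (\<iota> x)\<close>.
\<close>

lemma norming_functional:
  assumes fin: "finite_dimensional_on sc V" and v: "v \<in> V"
  shows "\<exists>\<phi>\<in>dual_ball sc V N. N v \<le> norm (\<phi> v)"
proof -
  obtain B where B: "finite B" "span B = V"
    using fin unfolding finite_dimensional_on_def by blast
  then have BV: "B \<subseteq> V" using span_superset by blast
  note V [simp] = subspace_add[OF subspace] subspace_scale[OF subspace] subspace_neg[OF subspace]
  \<comment> \<open>Symmetrizing the norm at \<open>v\<close> comes first: the bound
    \<open>q0 (- v) <= - N v\<close> passes to every smaller functional, and once that functional is
    symmetric it says that \<open>v\<close> is normed.\<close>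
  obtain q0 where q0: "real_sublinear_on sc V q0" "\<forall>x\<in>V. q0 x \<le> N x" "q0 (- v) \<le> - N v"
    using real_sublinear_symmetrize[OF real_sublinear_norm v] by blast
  have *: "\<exists>q. real_sublinear_on sc V q \<and> (\<forall>x\<in>V. q x \<le> N x) \<and> N v \<le> - q (- v) \<and> (\<forall>b\<in>S. q (- b) = - q b)"
    if S: "finite S" "S \<subseteq> V" for S
  proof -
    obtain q where q: "real_sublinear_on sc V q" "\<forall>x\<in>V. q x \<le> q0 x" "\<forall>b\<in>S. q (- b) = - q b"
      using real_sublinear_symmetrize_finite[OF S q0(1)] by blast
    have "q (- v) \<le> q0 (- v)" using q(2) v by simp
    then have "N v \<le> - q (- v)" using q0(3) by simp
    with q q0(2) show ?thesis by (meson order_trans)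
  qed
  show ?thesis
  proof (cases rule: scalar_cases[where 'k='k])
    case real
    obtain q where q: "real_sublinear_on sc V q" "\<forall>x\<in>V. q x \<le> N x" "N v \<le> - q (- v)" "\<forall>b\<in>B. q (- b) = - q b"
      using *[OF B(1) BV] by blast
    have "q (- sc c b) = - q (sc c b)" if "b \<in> B" for b c
      using real[of c] symmetric_scale(2)[OF q(1)] that q(4) BV by blast
    then have sym: "q (- x) = - q x" if "x \<in> V" for x
      using symmetric_on_span[OF q(1) BV] B(2) that by blast
    define \<phi> :: "'a \<Rightarrow> 'k" where "\<phi> x = of_real (q x)" for x
    have "linear_map_on sc V (*) \<phi>"
      unfolding linear_map_on_def
    proof (intro conjI ballI allI)
      fix x y assume "x \<in> V" "y \<in> V"
      then show "\<phi> (x + y) = \<phi> x + \<phi> y"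
        using symmetric_add(1)[OF q(1)] sym by (simp add: \<phi>_def)
    next
      fix c :: 'k and x assume x: "x \<in> V"
      obtain r where "c = of_real r" using real by blast
      then show "\<phi> (sc c x) = c * \<phi> x"
        using symmetric_scale(1)[OF q(1)] sym x by (simp add: \<phi>_def)
    qed
    moreover have "norm (\<phi> x) \<le> N x" if "x \<in> V" for x
    proof -
      have "N (- x) = N x" using norm_scale[OF that, of "-1"] by simp
      moreover have "q x \<le> N x" "q (- x) \<le> N (- x)"
        using bspec[OF q(2) that] bspec[OF q(2) subspace_neg[OF subspace that]] by auto
      ultimately show ?thesis using sym[OF that] by (simp add: \<phi>_def)
    qed
    ultimately have "\<phi> \<in> dual_ball sc V N" by (rule bounded_functional_in_dual_ball)
    moreover have "N v \<le> norm (\<phi> v)" using q(3) sym[OF v] by (simp add: \<phi>_def)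
    ultimately show ?thesis by blast
  next
    case (complex \<iota>)
    \<comment> \<open>A spanning set over the complex scalars becomes a real spanning set when its
      multiples by \<open>\<iota>\<close> are added.\<close>
    let ?S = "B \<union> sc \<iota> ` B"
    have S: "finite ?S" "?S \<subseteq> V" using B(1) BV by auto
    then obtain q where q: "real_sublinear_on sc V q" "\<forall>x\<in>V. q x \<le> N x" "N v \<le> - q (- v)" "\<forall>b\<in>?S. q (- b) = - q b"
      using *[OF S] by blast
    have "q (- sc c b) = - q (sc c b)" if "b \<in> B" for b c
    proof -
      obtain r s where c: "c = of_real r + of_real s * \<iota>" using complex(2) by blast
      have b: "b \<in> V" "sc \<iota> b \<in> V" using that BV by auto
      have "sc c b = sc (of_real r) b + sc (of_real s) (sc \<iota> b)"
        by (simp add: c scale_left_distrib)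
      moreover have "q (- b) = - q b" "q (- sc \<iota> b) = - q (sc \<iota> b)" using q(4) that by blast+
      note this[THEN symmetric_scale(2)[OF q(1), rotated]]
      then have "q (- sc (of_real r) b) = - q (sc (of_real r) b)"
        "q (- sc (of_real s) (sc \<iota> b)) = - q (sc (of_real s) (sc \<iota> b))"
        using b by blast+
      ultimately show ?thesis
        using symmetric_add(2)[OF q(1) V(2)[OF b(1)] V(2)[OF b(2)]] by metis
    qed
    then have sym: "q (- x) = - q x" if "x \<in> V" for x
      using symmetric_on_span[OF q(1) BV] B(2) that by blast
    have add: "q (x + y) = q x + q y" if "x \<in> V" "y \<in> V" for x y
      using symmetric_add(1)[OF q(1) that] sym that by blast
    have scale: "q (sc (of_real r) x) = r * q x" if "x \<in> V" for r x
      using symmetric_scale(1)[OF q(1) that] sym that by blast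
    define \<phi> :: "'a \<Rightarrow> 'k" where "\<phi> x = of_real (q x) + of_real (- q (sc \<iota> x)) * \<iota>" for x
    have \<phi>_norm: "norm (\<phi> x) = sqrt ((q x)\<^sup>2 + (q (sc \<iota> x))\<^sup>2)" for x
      unfolding \<phi>_def by (subst complex(3)) simp
    have lin: "linear_map_on sc V (*) \<phi>"
      unfolding linear_map_on_def
    proof (intro conjI ballI allI)
      fix x y assume "x \<in> V" "y \<in> V"
      then show "\<phi> (x + y) = \<phi> x + \<phi> y"
        by (simp add: \<phi>_def add scale_right_distrib algebra_simps)
    next
      fix c :: 'k and x assume x: "x \<in> V"
      obtain r s where c: "c = of_real r + of_real s * \<iota>" using complex(2) by blast
      have "sc c x = sc (of_real r) x + sc (of_real s) (sc \<iota> x)"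
        by (simp add: c scale_left_distrib)
      then have 1: "q (sc c x) = r * q x + s * q (sc \<iota> x)"
        using x by (simp only: add scale V)
      have "\<iota> * c = of_real (- s) + of_real r * \<iota>" 
      proof -
        have "\<iota> * c = of_real s * (\<iota> * \<iota>) + of_real r * \<iota>" by (simp add: c algebra_simps)
        then show ?thesis by (simp add: complex(1))
      qed
      then have "sc \<iota> (sc c x) = sc (of_real (- s)) x + sc (of_real r) (sc \<iota> x)"
        by (simp only: scale_scale scale_left_distrib)
      then have 2: "q (sc \<iota> (sc c x)) = (- s) * q x + r * q (sc \<iota> x)"
        using x by (simp only: add scale V)
      have "c * \<phi> x = (of_real r * of_real (q x) - of_real s * of_real (q (sc \<iota> x)) * (\<iota> * \<iota>)) +
          (of_real s * of_real (q x) - of_real r * of_real (q (sc \<iota> x))) * \<iota>"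
        by (simp add: c \<phi>_def algebra_simps)
      also have "\<dots> = \<phi> (sc c x)"
        unfolding \<phi>_def 1 2 complex(1) by (simp add: algebra_simps)
      finally show "\<phi> (sc c x) = c * \<phi> x" ..
    qed
    moreover have "norm (\<phi> x) \<le> N x" if x: "x \<in> V" for x
    proof (cases "\<phi> x = 0")
      case True
      then show ?thesis using norm_nonneg[OF x] by simp
    next
      case False
      \<comment> \<open>Rotating \<open>x\<close> by a scalar of norm 1 makes the value of
        \<open>\<phi>\<close> real and nonnegative. It then equals its real part
        \<open>q (sc c x)\<close>, which is bounded by the norm.\<close>
      define c where "c = of_real (norm (\<phi> x)) / \<phi> x"
      have c: "norm c = 1" using False by (simp add: c_def norm_divide)
      have "\<phi> (sc c x) = c * \<phi> x" using lin x unfolding linear_map_on_def by blast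
      also have "\<dots> = of_real (norm (\<phi> x))" using False by (simp add: c_def)
      finally have eq: "of_real (q (sc c x) - norm (\<phi> x)) + of_real (- q (sc \<iota> (sc c x))) * \<iota> = 0"
        by (simp add: \<phi>_def[of "sc c x"] diff_eq_eq)
      have "sqrt ((q (sc c x) - norm (\<phi> x))\<^sup>2 + (- q (sc \<iota> (sc c x)))\<^sup>2) = 0"
        unfolding complex(3)[symmetric] eq by simp
      then have "q (sc c x) - norm (\<phi> x) = 0" by (simp add: add_nonneg_eq_0_iff)
      moreover have "q (sc c x) \<le> N (sc c x)" using q(2) x by simp
      ultimately show ?thesis using c norm_scale[OF x, of c] by simp
    qed
    ultimately have "\<phi> \<in> dual_ball sc V N" by (rule bounded_functional_in_dual_ball)
    moreover have "\<bar>q v\<bar> \<le> norm (\<phi> v)" unfolding \<phi>_norm by (rule real_le_rsqrt) simp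
    ultimately show ?thesis using q(3) sym[OF v] by (intro bexI[of _ \<phi>]) auto
  qed
qed

section \<open>Biorthogonal systems and almost Auerbach bases\<close>

lemma functional_zero: "linear_map_on sc V (*) \<phi> \<Longrightarrow> \<phi> 0 = (0 :: 'k)"
  using linear_map_on_zero[OF vector_space_axioms vector_space_field] subspace_0[OF subspace] by blast

lemma functional_add_scale:
  "linear_map_on sc V (*) \<phi> \<Longrightarrow> x \<in> V \<Longrightarrow> y \<in> V \<Longrightarrow> \<phi> (sc c x + y) = c * \<phi> x + \<phi> y"
  using subspace_scale[OF subspace] unfolding linear_map_on_def by metis

text \<open>Gram-Schmidt with functionals in place of an inner product: each new vector is
  annihilated by all earlier functionals, and a functional norming it is added. For
  \<open>k = dim V\<close> the system yields a point where the determinant to be maximized does not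
  vanish.\<close>

lemma triangular_system:
  assumes fin: "finite_dimensional_on sc V" and "k \<le> dim V"
  shows "\<exists>\<phi> x. \<forall>i<k. \<phi> i \<in> dual_ball sc V N \<and> x i \<in> V \<and> \<phi> i (x i) \<noteq> 0 \<and> (\<forall>j<k. i < j \<longrightarrow> \<phi> i (x j) = 0)"
  using assms(2)
proof (induction k)
  case 0
  then show ?case by simp
next
  case (Suc k)
  obtain \<phi> x where *: "\<forall>i<k. \<phi> i \<in> dual_ball sc V N \<and> x i \<in> V \<and> \<phi> i (x i) \<noteq> 0 \<and>
      (\<forall>j<k. i < j \<longrightarrow> \<phi> i (x j) = 0)"
    using Suc.IH[OF Suc_leD[OF Suc.prems]] by blast
  then have \<phi>: "\<And>i. i < k \<Longrightarrow> \<phi> i \<in> dual_ball sc V N"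
    and x: "\<And>i. i < k \<Longrightarrow> x i \<in> V" and nz: "\<And>i. i < k \<Longrightarrow> \<phi> i (x i) \<noteq> 0"
    by blast+
  have tri: "\<phi> i (x j) = 0" if "i < j" "j < k" for i j
    using * that less_trans by blast
  define X where "X = x ` {..<k}"
  have "card X < dim V" using card_image_le[of "{..<k}" x] Suc.prems by (simp add: X_def)
  then have "\<not> V \<subseteq> span X" using dim_le_card[of V X] by (auto simp: X_def)
  then obtain y where y: "y \<in> V" "y \<notin> span X" by blast
  \<comment> \<open>The vector \<open>y\<close> is corrected modulo the span of \<open>X\<close>,
    one functional at a time. By triangularity, adding a multiple of \<open>x m\<close> does not
    disturb the zeros at the functionals before \<open>m\<close>.\<close>
  have "\<exists>w\<in>V. y - w \<in> span X \<and> (\<forall>i<m. \<phi> i w = 0)" if "m \<le> k" for m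
    using that
  proof (induction m)
    case 0
    then show ?case using y(1) span_zero by (intro bexI[of _ y]) auto
  next
    case (Suc m)
    then obtain w where w: "w \<in> V" "y - w \<in> span X" "\<forall>i<m. \<phi> i w = 0" by auto
    define c where "c = - \<phi> m w / \<phi> m (x m)"
    have m: "m < k" using Suc.prems by simp
    have "\<phi> i (sc c (x m) + w) = 0" if "i < Suc m" for i
    proof -
      have "\<phi> i (sc c (x m) + w) = c * \<phi> i (x m) + \<phi> i w"
        using that m \<phi>[of i] x[of m] w(1) by (intro functional_add_scale dual_ball_linear) auto
      moreover have "c * \<phi> m (x m) = - \<phi> m w" using nz[OF m] by (simp add: c_def)
      ultimately show ?thesis using that w(3) tri[of i m] m by (cases "i = m") auto
    qed
    moreover have "y - (sc c (x m) + w) \<in> span X"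
    proof -
      have "(y - w) - sc c (x m) \<in> span X"
        using m by (intro span_diff[OF w(2)] span_scale span_base) (simp add: X_def)
      then show ?thesis by (simp add: algebra_simps)
    qed
    moreover have "sc c (x m) + w \<in> V"
      using m x w(1) by (intro subspace_add[OF subspace] subspace_scale[OF subspace]) auto
    ultimately show ?case by blast
  qed
  then obtain w where w: "w \<in> V" "y - w \<in> span X" "\<forall>i<k. \<phi> i w = 0" by blast
  have "w \<noteq> 0" using w(2) y(2) by auto
  then have "0 < N w" using norm_nonneg[OF w(1)] norm_eq_zero[OF w(1)] by linarith
  then obtain \<psi> where \<psi>: "\<psi> \<in> dual_ball sc V N" "\<psi> w \<noteq> 0"
    using norming_functional[OF fin w(1)] by force
  show ?case
    using \<phi> x nz tri w \<psi>
    by (intro exI[of _ "\<phi>(k := \<psi>)"] exI[of _ "x(k := w)"]) (auto simp: less_Suc_eq)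
qed

text \<open>Since \<open>f i\<close> kills every \<open>x j\<close> except \<open>x i\<close>, the
  vectors are independent. Being \<open>dim V\<close> in number they span \<open>V\<close>, and the
  \<open>f i\<close> read off the coefficients.\<close>

lemma biorthogonal_expansion:
  assumes fin: "finite_dimensional_on sc V" and x: "\<And>i. i < dim V \<Longrightarrow> x i \<in> V"
    and lin: "\<And>i. i < dim V \<Longrightarrow> linear_map_on sc V (*) (f i)"
    and bi: "\<And>i j. i < dim V \<Longrightarrow> j < dim V \<Longrightarrow> f i (x j) = (if i = j then 1 else 0)"
    and y: "y \<in> V"
  shows "y = (\<Sum>i<dim V. sc (f i y) (x i))"
proof -
  note V [simp] = subspace_add[OF subspace] subspace_scale[OF subspace]
  define X where "X = x ` {..<dim V}"
  have XV: "X \<subseteq> V" using x by (auto simp: X_def)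
  have inj: "inj_on x {..<dim V}"
    using bi by (metis inj_onI lessThan_iff zero_neq_one)
  have card: "card X = dim V" using card_image[OF inj] by (simp add: X_def)
  have ind: "independent X"
    unfolding dependent_def
  proof clarify
    fix a assume a: "a \<in> X" "a \<in> span (X - {a})"
    then obtain i where i: "i < dim V" "a = x i" by (auto simp: X_def)
    have "subspace {z \<in> V. f i z = 0}"
      using lin[OF i(1)] functional_zero[OF lin[OF i(1)]] subspace_0[OF subspace]
      by (intro subspaceI) (auto simp: linear_map_on_def)
    moreover have "X - {a} \<subseteq> {z \<in> V. f i z = 0}"
      using x bi i by (auto simp: X_def)
    ultimately have "f i a = 0" using a(2) span_minimal by blast
    then show False using bi[OF i(1) i(1)] i by simp
  qed
  have "y \<in> span X"
  proof (rule ccontr)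
    assume "y \<notin> span X"
    then have ind': "independent (insert y X)" "y \<notin> X"
      using ind span_base independent_insert by metis+
    obtain B0 where B0: "finite B0" "span B0 = V"
      using fin unfolding finite_dimensional_on_def by blast
    obtain B where B: "B \<subseteq> V" "independent B" "V \<subseteq> span B" "card B = dim V"
      by (rule basis_exists)
    \<comment> \<open>The equation \<open>card B = dim V\<close> does not exclude an infinite
      \<open>B\<close>, whose cardinality would be 0; finiteness comes from the finite spanning set
      \<open>B0\<close>.\<close>
    have "finite B" using independent_span_bound[OF B0(1) B(2)] B(1) B0(2) by simp
    moreover have "insert y X \<subseteq> span B" using y XV B(3) by blast
    ultimately have "card (insert y X) \<le> dim V"
      using independent_span_bound[of B "insert y X"] ind'(1) B(4) by simp
    moreover have "finite X" by (simp add: X_def)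
    ultimately show False using ind'(2) card by simp
  qed
  then have "y \<in> V \<and> y = (\<Sum>i<dim V. sc (f i y) (x i))"
  proof (induction rule: span_induct_alt)
    case base
    then show ?case using functional_zero[OF lin] subspace_0[OF subspace] by simp
  next
    case (step c v y)
    then obtain k where k: "k < dim V" "v = x k" by (auto simp: X_def)
    have "(\<Sum>i<dim V. sc (f i (sc c v + y)) (x i)) =
        (\<Sum>i<dim V. (if i = k then sc c (x k) else 0) + sc (f i y) (x i))"
      using step k x lin bi
      by (intro sum.cong) (auto simp: functional_add_scale scale_left_distrib)
    also have "\<dots> = sc c v + y"
      using step.IH k by (simp add: sum.distrib)
    finally show ?case using step.IH k x by simp
  qed
  then show ?thesis by blast
qed

text \<open>
  Auerbach's lemma up to a factor \<open>t > 1\<close>, which avoids compactness: the vectors almost maximize a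
  non-zero determinant over the unit ball, and the functionals are given by Cramer's rule.
\<close>

lemma almost_auerbach:
  assumes fin: "finite_dimensional_on sc V" and t: "1 < t"
  shows "\<exists>e f. (\<forall>i<dim V. e i \<in> V \<and> N (e i) \<le> 1 \<and> linear_map_on sc V (*) (f i) \<and>
      (\<forall>y\<in>V. norm (f i y) \<le> t * N y)) \<and> (\<forall>y\<in>V. y = (\<Sum>i<dim V. sc (f i y) (e i)))"
proof -
  define d where "d = dim V"
  obtain \<phi> u where *: "\<forall>i<d. \<phi> i \<in> dual_ball sc V N \<and> u i \<in> V \<and> \<phi> i (u i) \<noteq> 0 \<and>
      (\<forall>j<d. i < j \<longrightarrow> \<phi> i (u j) = 0)"
    using triangular_system[OF fin order_refl] unfolding d_def by blast
  then have \<phi>: "\<And>i. i < d \<Longrightarrow> \<phi> i \<in> dual_ball sc V N"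
    and u: "\<And>i. i < d \<Longrightarrow> u i \<in> V" "\<And>i. i < d \<Longrightarrow> \<phi> i (u i) \<noteq> 0"
    by blast+
  have tri: "\<phi> i (u j) = 0" if "i < j" "j < d" for i j
    using * that less_trans by blast
  \<comment> \<open>Row \<open>k\<close> of the matrix belongs to the vector \<open>x k\<close>; the
    tuples in \<open>P\<close> have all their vectors in the unit ball, and \<open>s\<close> is the
    supremum to be nearly attained.\<close>
  define D where "D x = Determinant.det (mat d d (\<lambda>(k, j). \<phi> j (x k)))" for x
  define P where "P = {x. \<forall>i<d. x i \<in> V \<and> N (x i) \<le> 1}"
  define s where "s = (SUP x\<in>P. norm (D x))"
  have "norm (D x) \<le> real (card {p. p permutes {0..<d}})" if "x \<in> P" for x
    unfolding D_def
  proof (rule norm_det_le_card_permutations)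
    fix i j assume ij: "i < d" "j < d"
    then have "norm (\<phi> j (x i)) \<le> N (x i)" "N (x i) \<le> 1"
      using dual_ball_bound[OF \<phi>] that by (auto simp: P_def)
    then show "norm (mat d d (\<lambda>(k, j). \<phi> j (x k)) $$ (i, j)) \<le> 1" using ij by simp
  qed simp
  then have bdd: "bdd_above ((\<lambda>x. norm (D x)) ` P)" by (rule bdd_aboveI2)
  have le_s: "norm (D x) \<le> s" if "x \<in> P" for x
    unfolding s_def using that by (intro cSUP_upper bdd)
  have u_nz: "u i \<noteq> 0" if "i < d" for i
    using functional_zero[OF dual_ball_linear[OF \<phi>[OF that]]] u(2)[OF that] by auto
  \<comment> \<open>Normalizing the triangular system gives a point of \<open>P\<close>. As
    \<open>\<phi> j (x0 k)\<close> vanishes for \<open>j < k\<close>, its matrix is upper triangular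
    with nonzero diagonal, which makes \<open>s\<close> positive.\<close>
  define x0 where "x0 i = sc (of_real (1 / N (u i))) (u i)" for i
  have x0: "x0 \<in> P"
    using u u_nz norm_normalize by (auto simp: P_def x0_def subspace_scale[OF subspace])
  have \<phi>x0: "\<phi> i (x0 j) = of_real (1 / N (u j)) * \<phi> i (u j)" if "i < d" "j < d" for i j
    using dual_ball_linear[OF \<phi>[OF that(1)]] u(1)[OF that(2)] unfolding x0_def linear_map_on_def by blast
  have "D x0 = prod_list (diag_mat (mat d d (\<lambda>(k, j). \<phi> j (x0 k))))"
    unfolding D_def using tri by (intro det_upper_triangular[of _ d]) (auto simp: \<phi>x0)
  moreover have "\<phi> i (x0 i) \<noteq> 0" if "i < d" for i
    using u u_nz[OF that] norm_eq_zero that by (simp add: \<phi>x0)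
  ultimately have "D x0 \<noteq> 0" by (auto simp: prod_list_zero_iff diag_mat_def)
  then have "0 < s" using le_s[OF x0] by (meson less_le_trans zero_less_norm_iff)
  then have "s / t < s" using t by (simp add: field_simps)
  then obtain x where x: "x \<in> P" "s / t < norm (D x)"
    using less_cSUP_iff[OF _ bdd] x0 unfolding s_def by blast
  have Dx: "D x \<noteq> 0" "s \<le> t * norm (D x)" 
    using x(2) \<open>0 < s\<close> t by (auto simp: field_simps)
  have xV: "x i \<in> V" "N (x i) \<le> 1" if "i < d" for i using x(1) that by (auto simp: P_def)
  define f where "f i y = D (x(i := y)) / D x" for i y
  have lin: "linear_map_on sc V (*) (f i)" if i: "i < d" for i
  proof -
    obtain c where c: "\<And>y. D (x(i := y)) = (\<Sum>j<d. \<phi> j y * c j)"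
      using det_replace_row[OF i, of \<phi> x] unfolding D_def by blast
    have lin: "linear_map_on sc V (*) (\<phi> j)" if "j < d" for j
      using dual_ball_linear[OF \<phi>[OF that]] .
    show ?thesis
      unfolding linear_map_on_def
    proof (intro conjI ballI allI)
      fix y z assume "y \<in> V" "z \<in> V"
      then have "(\<Sum>j<d. \<phi> j (y + z) * c j) = (\<Sum>j<d. \<phi> j y * c j + \<phi> j z * c j)"
        using lin by (intro sum.cong) (auto simp: linear_map_on_def algebra_simps)
      then show "f i (y + z) = f i y + f i z"
        by (simp add: f_def c sum.distrib add_divide_distrib)
    next
      fix a y assume "y \<in> V"
      then have "(\<Sum>j<d. \<phi> j (sc a y) * c j) = (\<Sum>j<d. a * (\<phi> j y * c j))"
        using lin by (intro sum.cong) (auto simp: linear_map_on_def)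
      then show "f i (sc a y) = a * f i y"
        by (simp add: f_def c flip: sum_distrib_left)
    qed
  qed
  have bound: "norm (f i y) \<le> t * N y" if i: "i < d" and y: "y \<in> V" for i y
  proof (cases "y = 0")
    case True
    then show ?thesis using functional_zero[OF lin[OF i]] norm_nonneg[OF y] t by simp
  next
    case False
    let ?y = "sc (of_real (1 / N y)) y"
    have pos: "0 < N y" using norm_nonneg[OF y] norm_eq_zero[OF y] False by linarith
    \<comment> \<open>Replacing one vector by a unit vector stays in \<open>P\<close>, so the new
      determinant has norm at most \<open>s\<close>, hence at most \<open>t\<close> times that of
      \<open>D x\<close>; the quotient \<open>f i ?y\<close> is therefore bounded by
      \<open>t\<close>.\<close>
    have "x(i := ?y) \<in> P"
      using x(1) norm_normalize[OF y False] subspace_scale[OF subspace y] by (simp add: P_def)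
    then have "norm (D (x(i := ?y))) \<le> t * norm (D x)" using le_s Dx(2) by (meson order_trans)
    then have "norm (f i ?y) \<le> t" using Dx(1) by (simp add: f_def norm_divide pos_divide_le_eq)
    moreover have "f i ?y = of_real (1 / N y) * f i y"
      using lin[OF i] y unfolding linear_map_on_def by blast
    ultimately show ?thesis using pos by (simp add: norm_mult norm_divide pos_divide_le_eq)
  qed
  have bi: "f i (x j) = (if i = j then 1 else 0)" if ij: "i < d" "j < d" for i j
  proof (cases "i = j")
    case True
    then show ?thesis using Dx(1) by (simp add: f_def)
  next
    case False
    have "D (x(i := x j)) = 0"
      unfolding D_def using False ij
      by (intro det_identical_rows[of _ d i j]) (auto intro!: eq_vecI)
    then show ?thesis using False by (simp add: f_def)
  qed
  have "y = (\<Sum>i<d. sc (f i y) (x i))" if "y \<in> V" for y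
    using biorthogonal_expansion[OF fin, of x f y] xV(1) lin bi that by (simp only: d_def)
  then show ?thesis
    using xV lin bound unfolding d_def by (intro exI[of _ x] exI[of _ f]) blast
qed

end

section \<open>Expansion of multilinear maps\<close>

lemma sum_fun_apply: "(\<Sum>i\<in>I. g i) A = (\<Sum>i\<in>I. g i A)"
  by (induction I rule: infinite_finite_induct) auto

lemma linear_map_on_sum:
  assumes s1: "vector_space s1" and s2: "vector_space s2" and V: "module.subspace s1 V"
    and T: "linear_map_on s1 V s2 T" and v: "\<And>i. i \<in> I \<Longrightarrow> v i \<in> V"
  shows "T (\<Sum>i\<in>I. v i) = (\<Sum>i\<in>I. T (v i))"
proof -
  interpret s1: vector_space s1 by fact
  have "(\<Sum>i\<in>I. v i) \<in> V \<and> T (\<Sum>i\<in>I. v i) = (\<Sum>i\<in>I. T (v i))"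
    using v
  proof (induction I rule: infinite_finite_induct)
    case (insert i I)
    then show ?case using T s1.subspace_add[OF V] by (simp add: linear_map_on_def)
  qed (use linear_map_on_zero[OF s1 s2 T] s1.subspace_0[OF V] in auto)
  then show ?thesis by blast
qed

lemma sum_PiE_insert:
  assumes "i \<notin> J" "finite J"
  shows "(\<Sum>k\<in>Pi\<^sub>E (insert i J) I. h k) = (\<Sum>k\<in>Pi\<^sub>E J I. \<Sum>l\<in>I i. h (k(i := l)))"
proof -
  have "(\<Sum>k\<in>Pi\<^sub>E (insert i J) I. h k) = (\<Sum>(l, k)\<in>I i \<times> Pi\<^sub>E J I. h (k(i := l)))"
    unfolding PiE_insert_eq
    by (subst sum.reindex[OF inj_combinator[OF assms(1)]]) (simp add: case_prod_unfold)
  also have "\<dots> = (\<Sum>l\<in>I i. \<Sum>k\<in>Pi\<^sub>E J I. h (k(i := l)))"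
    by (rule sum.cartesian_product[symmetric])
  finally show ?thesis by (subst sum.swap)
qed

text \<open>Induction on \<open>J\<close> expands one slot after the other. Values in an arbitrary
  vector space are allowed because the lemma is applied to the map \<open>elementary_tensor\<close>
  itself.\<close>

lemma multilinear_expansion:
  assumes sc: "vector_space sc" and s: "vector_space s"
    and F: "\<And>j. j \<in> {1..n} \<Longrightarrow> module.subspace sc (F j)"
    and A: "multilinear_on n sc F s A"
    and e: "\<And>j l. j \<in> J \<Longrightarrow> l \<in> I j \<Longrightarrow> e j l \<in> F j"
    and exp: "\<And>j y. j \<in> J \<Longrightarrow> y \<in> F j \<Longrightarrow> y = (\<Sum>l\<in>I j. sc (f j l y) (e j l))"
    and J: "J \<subseteq> {1..n}" and x: "x \<in> (\<Pi>\<^sub>E j\<in>{1..n}. F j)"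
  shows "A x = (\<Sum>k\<in>Pi\<^sub>E J I. s (\<Prod>j\<in>J. f j (k j) (x j)) (A (\<lambda>j. if j \<in> J then e j (k j) else x j)))"
proof -
  interpret sc: vector_space sc by fact
  interpret s: vector_space s by fact
  have "finite J" using J finite_subset by blast
  then show ?thesis
    using e exp J
  proof (induction J rule: finite_induct)
    case empty
    then show ?case by simp
  next
    case (insert i J)
    define y where "y k = (\<lambda>j. if j \<in> J then e j (k j) else x j)" for k
    have i: "i \<in> {1..n}" using insert.prems by simp
    have yP: "y k \<in> (\<Pi>\<^sub>E j\<in>{1..n}. F j)" if "k \<in> Pi\<^sub>E J I" for k
      using x insert.prems(1,3) that by (fastforce simp: y_def PiE_iff extensional_def)
    have xi: "x i \<in> F i" using x i by blast
    have "A (y k) = (\<Sum>l\<in>I i. s (f i l (x i)) (A ((y k)(i := e i l))))" if k: "k \<in> Pi\<^sub>E J I" for k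
    proof -
      have lin: "linear_map_on sc (F i) s (\<lambda>u. A ((y k)(i := u)))"
        using A yP[OF k] i unfolding multilinear_on_def by blast
      \<comment> \<open>Since \<open>i\<close> is not in \<open>J\<close>, slot \<open>i\<close> of
        \<open>y k\<close> still holds \<open>x i\<close> and can be expanded.\<close>
      have "y k = (y k)(i := x i)" using insert.hyps by (simp add: y_def fun_eq_iff)
      also have "x i = (\<Sum>l\<in>I i. sc (f i l (x i)) (e i l))"
        using insert.prems(2) xi by blast
      finally have "A (y k) = A ((y k)(i := \<Sum>l\<in>I i. sc (f i l (x i)) (e i l)))"
        by metis
      also have "\<dots> = (\<Sum>l\<in>I i. A ((y k)(i := sc (f i l (x i)) (e i l))))"
        by (rule linear_map_on_sum[OF sc s F[OF i] lin])
          (use insert.prems(1) sc.subspace_scale[OF F[OF i]] in blast)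
      also have "\<dots> = (\<Sum>l\<in>I i. s (f i l (x i)) (A ((y k)(i := e i l))))"
        using lin insert.prems(1) unfolding linear_map_on_def by (intro sum.cong) auto
      finally show ?thesis .
    qed
    then have "A x = (\<Sum>k\<in>Pi\<^sub>E J I. \<Sum>l\<in>I i. s (\<Prod>j\<in>J. f j (k j) (x j)) (s (f i l (x i)) (A ((y k)(i := e i l)))))"
      using insert.IH insert.prems by (simp add: y_def s.scale_sum_right)
    also have "\<dots> = (\<Sum>k\<in>Pi\<^sub>E (insert i J) I. s (\<Prod>j\<in>insert i J. f j (k j) (x j))
        (A (\<lambda>j. if j \<in> insert i J then e j (k j) else x j)))"
      unfolding sum_PiE_insert[OF insert.hyps(2,1)]
    proof (intro sum.cong refl)
      fix k l
      have "(\<Prod>j\<in>J. f j ((k(i := l)) j) (x j)) = (\<Prod>j\<in>J. f j (k j) (x j))"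
        using insert.hyps by (intro prod.cong) auto
      moreover have "(y k)(i := e i l) = (\<lambda>j. if j \<in> insert i J then e j ((k(i := l)) j) else x j)"
        using insert.hyps by (auto simp: y_def fun_eq_iff)
      ultimately show "s (\<Prod>j\<in>J. f j (k j) (x j)) (s (f i l (x i)) (A ((y k)(i := e i l)))) =
          s (\<Prod>j\<in>insert i J. f j ((k(i := l)) j) (x j))
            (A (\<lambda>j. if j \<in> insert i J then e j ((k(i := l)) j) else x j))"
        using insert.hyps by (simp add: mult.commute)
    qed
    finally show ?case .
  qed
qed

section \<open>Comparison of the projective and injective norms\<close>

locale normed_tensor_product =
  fixes sc :: "'k::real_or_complex_field \<Rightarrow> 'a::ab_group_add \<Rightarrow> 'a"
    and n :: nat and F :: "nat \<Rightarrow> 'a set" and N :: "nat \<Rightarrow> 'a \<Rightarrow> real"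
  assumes n_pos: "1 \<le> n"
    and normed: "\<And>j. j \<in> {1..n} \<Longrightarrow> normed_space_on sc (F j) (N j)"
begin

sublocale vector_space sc
  using normed_space_on.axioms(1)[OF normed[of 1]] n_pos by simp

interpretation ts: vector_space "tensor_scale :: 'k \<Rightarrow> ('k, 'a) tensor \<Rightarrow> ('k, 'a) tensor"
  by (rule vector_space_tensor_scale)

abbreviation P where "P \<equiv> \<Pi>\<^sub>E j\<in>{1..n}. F j"
abbreviation elt where "elt \<equiv> elementary_tensor n sc F"
abbreviation T where "T \<equiv> tensor_space n sc F"
abbreviation pi_norm where "pi_norm \<equiv> projective_norm n sc F N"
abbreviation eps_norm where "eps_norm \<equiv> injective_norm n sc F N"

lemma subspace_factor: "j \<in> {1..n} \<Longrightarrow> subspace (F j)"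
  using normed_space_on.subspace[OF normed] .

lemma elt_linear: "x \<in> P \<Longrightarrow> j \<in> {1..n} \<Longrightarrow> linear_map_on sc (F j) tensor_scale (\<lambda>u. elt (x(j := u)))"
  using multilinear_elementary_tensor unfolding multilinear_on_def by blast

lemma elt_scale:
  assumes "x \<in> P" "j \<in> {1..n}"
  shows "elt (x(j := sc c (x j))) = tensor_scale c (elt x)"
  using elt_linear[OF assms] assms unfolding linear_map_on_def by (metis PiE_mem fun_upd_triv)

lemma update_in_P: "x \<in> P \<Longrightarrow> j \<in> {1..n} \<Longrightarrow> u \<in> F j \<Longrightarrow> x(j := u) \<in> P"
  by (auto simp: PiE_iff extensional_def)

text \<open>The scalars of a linear combination are absorbed into the first factor, which exists by
  \<open>n_pos\<close>. Hence the infimum in the projective norm is over a nonempty set.\<close>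

lemma tensor_representation:
  assumes "z \<in> T"
  shows "\<exists>(m::nat) x. (\<forall>i<m. x i \<in> P) \<and> z = (\<Sum>i<m. elt (x i))"
  using assms unfolding tensor_space_def
proof (induction rule: ts.span_induct_alt)
  case base
  show ?case by (rule exI[of _ 0]) simp
next
  case (step c v y)
  then obtain m :: nat and x where mx: "\<forall>i<m. x i \<in> P" "y = (\<Sum>i<m. elt (x i))" by blast
  obtain u where u: "u \<in> P" "v = elt u" using step by blast
  have 1: "1 \<in> {1..n}" using n_pos by simp
  define u' where "u' = u(1 := sc c (u 1))"
  have "u' \<in> P" unfolding u'_def
    using u 1 by (intro update_in_P subspace_scale[OF subspace_factor]) auto
  moreover have "tensor_scale c v + y = (\<Sum>i<Suc m. elt ((x(m := u')) i))"
    using elt_scale[OF u(1) 1, of c] by (simp add: mx u u'_def)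
  ultimately show ?case using mx(1) by (intro exI[of _ "Suc m"] exI[of _ "x(m := u')"]) (auto simp: less_Suc_eq)
qed

lemma prod_norm_nonneg: "x \<in> P \<Longrightarrow> 0 \<le> (\<Prod>j=1..n. N j (x j))"
  by (intro prod_nonneg ballI normed_space_on.norm_nonneg[OF normed]) auto

text \<open>The definition indexes representations by initial segments of the naturals; reindexing
  admits any finite set, later a set of multi-indices.\<close>

lemma projective_norm_le:
  assumes I: "finite I" and x: "\<And>i. i \<in> I \<Longrightarrow> x i \<in> P" and z: "z = (\<Sum>i\<in>I. elt (x i))"
  shows "pi_norm z \<le> (\<Sum>i\<in>I. \<Prod>j=1..n. N j (x i j))"
proof -
  obtain h where h: "bij_betw h {..<card I} I"
    using ex_bij_betw_nat_finite[OF I] by (auto simp: atLeast0LessThan)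
  have hI: "h i \<in> I" if "i < card I" for i using h that bij_betwE by blast
  show ?thesis
    unfolding projective_norm_def
  proof (rule cInf_lower)
    show "(\<Sum>i\<in>I. \<Prod>j=1..n. N j (x i j)) \<in> {\<Sum>i<m. \<Prod>j=1..n. N j (x i j) | (m::nat) x.
        (\<forall>i<m. x i \<in> P) \<and> z = (\<Sum>i<m. elt (x i))}"
      using x hI z sum.reindex_bij_betw[OF h, of "\<lambda>i. elt (x i)"]
        sum.reindex_bij_betw[OF h, of "\<lambda>i. \<Prod>j=1..n. N j (x i j)"]
      by (intro CollectI exI[of _ "card I"] exI[of _ "x \<circ> h"]) simp
  qed (auto intro!: bdd_belowI[of _ 0] sum_nonneg prod_norm_nonneg simp del: One_nat_def)
qed

lemma projective_norm_ge:
  assumes z: "z \<in> T"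
    and c: "\<And>(m::nat) x. (\<And>i. i < m \<Longrightarrow> x i \<in> P) \<Longrightarrow> z = (\<Sum>i<m. elt (x i)) \<Longrightarrow> c \<le> (\<Sum>i<m. \<Prod>j=1..n. N j (x i j))"
  shows "c \<le> pi_norm z"
  unfolding projective_norm_def
proof (rule cInf_greatest)
  show "{\<Sum>i<m. \<Prod>j=1..n. N j (x i j) | (m::nat) x.
        (\<forall>i<m. x i \<in> P) \<and> z = (\<Sum>i<m. elt (x i))} \<noteq> {}"
    using tensor_representation[OF z] by blast
qed (use c in blast)

lemma projective_norm_nonneg: "z \<in> T \<Longrightarrow> 0 \<le> pi_norm z"
  by (rule projective_norm_ge) (auto intro!: sum_nonneg prod_norm_nonneg simp del: One_nat_def)

lemma tensor_functional_sum:
  assumes "\<And>j. j \<in> {1..n} \<Longrightarrow> linear_map_on sc (F j) (*) (\<phi> j)"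
  shows "tensor_functional n \<phi> (\<Sum>i\<in>I. elt (x i)) = (\<Sum>i\<in>I. \<Prod>j=1..n. \<phi> j (x i j))"
  using tensor_functional_elementary[OF assms] by (simp add: tensor_functional_def sum_fun_apply)

text \<open>The functional is applied to each representation of \<open>z\<close>, followed by the
  infimum. Besides comparing the norms, this bounds the set whose supremum is the injective
  norm.\<close>

lemma tensor_functional_le_projective:
  assumes \<phi>: "\<And>j. j \<in> {1..n} \<Longrightarrow> \<phi> j \<in> dual_ball sc (F j) (N j)" and z: "z \<in> T"
  shows "norm (tensor_functional n \<phi> z) \<le> pi_norm z"
proof (rule projective_norm_ge[OF z])
  fix m :: nat and x assume x: "\<And>i. i < m \<Longrightarrow> x i \<in> P" and z: "z = (\<Sum>i<m. elt (x i))"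
  have "norm (tensor_functional n \<phi> z) = norm (\<Sum>i<m. \<Prod>j=1..n. \<phi> j (x i j))"
    unfolding z using \<phi>
    by (subst tensor_functional_sum) (auto intro: normed_space_on.dual_ball_linear[OF normed])
  also have "\<dots> \<le> (\<Sum>i<m. \<Prod>j=1..n. N j (x i j))"
  proof (rule sum_norm_le)
    fix i assume "i \<in> {..<m}"
    then have "x i \<in> P" using x by simp
    then show "norm (\<Prod>j=1..n. \<phi> j (x i j)) \<le> (\<Prod>j=1..n. N j (x i j))"
      unfolding prod_norm[symmetric] using \<phi>
      by (intro prod_mono conjI norm_ge_zero normed_space_on.dual_ball_bound[OF normed]) auto
  qed
  finally show "norm (tensor_functional n \<phi> z) \<le> (\<Sum>i<m. \<Prod>j=1..n. N j (x i j))" .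
qed

lemma tensor_functional_le_injective:
  assumes "\<And>j. j \<in> {1..n} \<Longrightarrow> \<phi> j \<in> dual_ball sc (F j) (N j)" and z: "z \<in> T"
  shows "norm (tensor_functional n \<phi> z) \<le> eps_norm z"
  unfolding injective_norm_def using assms tensor_functional_le_projective[OF _ z]
  by (intro cSup_upper bdd_aboveI[of _ "pi_norm z"]) auto

lemma zero_in_dual_ball: "j \<in> {1..n} \<Longrightarrow> (\<lambda>_. 0) \<in> dual_ball sc (F j) (N j)"
  using normed_space_on.norm_nonneg[OF normed]
  by (intro normed_space_on.bounded_functional_in_dual_ball[OF normed]) (auto simp: linear_map_on_def)

lemma injective_norm_nonneg: "z \<in> T \<Longrightarrow> 0 \<le> eps_norm z"
  by (rule order_trans[OF norm_ge_zero tensor_functional_le_injective[of "\<lambda>_ _. 0"]])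
    (rule zero_in_dual_ball)

lemma injective_le_projective:
  assumes "z \<in> T"
  shows "eps_norm z \<le> pi_norm z"
proof -
  define \<Phi> where "\<Phi> = {\<phi>. \<forall>j\<in>{1..n}. \<phi> j \<in> dual_ball sc (F j) (N j)}"
  have "(\<lambda>_ _. 0) \<in> \<Phi>" using zero_in_dual_ball by (simp add: \<Phi>_def)
  then have "(SUP \<phi>\<in>\<Phi>. norm (tensor_functional n \<phi> z)) \<le> pi_norm z"
    using tensor_functional_le_projective[OF _ assms] by (intro cSUP_least) (auto simp: \<Phi>_def)
  moreover have "eps_norm z = (SUP \<phi>\<in>\<Phi>. norm (tensor_functional n \<phi> z))"
    unfolding injective_norm_def \<Phi>_def by (simp add: image_Collect)
  ultimately show ?thesis by simp
qed

lemma zero_in_tensor_space: "0 \<in> T"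
  unfolding tensor_space_def by (rule ts.span_zero)

lemma norms_zero: "pi_norm 0 = 0" "eps_norm 0 = 0"
proof -
  have "pi_norm 0 \<le> 0" using projective_norm_le[of "{}" undefined 0] by simp
  then show "pi_norm 0 = 0" "eps_norm 0 = 0"
    using projective_norm_nonneg[OF zero_in_tensor_space]
      injective_norm_nonneg[OF zero_in_tensor_space] injective_le_projective[OF zero_in_tensor_space]
    by linarith+
qed

lemma projective_le_injective_factor:
  assumes fin: "\<And>j. j \<in> {1..n} \<Longrightarrow> finite_dimensional_on sc (F j)"
    and z: "z \<in> T" and t: "1 < t"
  shows "pi_norm z \<le> t ^ (n - 1) * (real (\<Prod>j=1..n-1. dim (F j)) * eps_norm z)"
proof -
  \<comment> \<open>Only the first \<open>n - 1\<close> slots are expanded, so the dimension of the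
    last factor does not enter; for \<open>n = 1\<close> the set is empty.\<close>
  define J where "J = {1..n-1}"
  have J: "J \<subseteq> {1..n}" "finite J" "n \<notin> J" "insert n J = {1..n}" "card J = n - 1"
    using n_pos by (auto simp: J_def)
  have n: "n \<in> {1..n}" using n_pos by simp
  have prod_split: "(\<Prod>j=1..n. g j) = g n * (\<Prod>j\<in>J. g j)" for g :: "nat \<Rightarrow> 'b::comm_monoid_mult"
    unfolding J(4)[symmetric] using J(2,3) by simp
  define Q where "Q j e f \<longleftrightarrow> (\<forall>i<dim (F j). e i \<in> F j \<and> N j (e i) \<le> 1 \<and> linear_map_on sc (F j) (*) (f i) \<and>
      (\<forall>y\<in>F j. norm (f i y) \<le> t * N j y)) \<and> (\<forall>y\<in>F j. y = (\<Sum>i<dim (F j). sc (f i y) (e i)))" for j e f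
  have "\<exists>e f. Q j e f" if "j \<in> J" for j
  proof -
    have "j \<in> {1..n}" using that J by blast
    from normed_space_on.almost_auerbach[OF normed[OF this] fin[OF this] t]
    show ?thesis unfolding Q_def .
  qed
  then obtain e f where Q: "\<And>j. j \<in> J \<Longrightarrow> Q j (e j) (f j)" by metis
  have e: "e j i \<in> F j" "N j (e j i) \<le> 1" and lin: "linear_map_on sc (F j) (*) (f j i)"
    and f: "\<And>y. y \<in> F j \<Longrightarrow> norm (f j i y) \<le> t * N j y" if "j \<in> J" "i < dim (F j)" for j i
    using Q[OF that(1)] that(2) unfolding Q_def by blast+
  have exp: "y = (\<Sum>i<dim (F j). sc (f j i y) (e j i))" if "j \<in> J" "y \<in> F j" for j y
    using Q[OF that(1)] that(2) unfolding Q_def by blast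
  obtain m :: nat and x where x: "\<And>i. i < m \<Longrightarrow> x i \<in> P" and z_eq: "z = (\<Sum>i<m. elt (x i))"
    using tensor_representation[OF z] by blast
  define K where "K = (\<Pi>\<^sub>E j\<in>J. {..<dim (F j)})"
  have K: "finite K" "card K = (\<Prod>j\<in>J. dim (F j))"
    using J(2) by (auto simp: K_def card_PiE intro: finite_PiE)
  have kJ: "k j < dim (F j)" if "k \<in> K" "j \<in> J" for k j
    using that by (auto simp: K_def)
  \<comment> \<open>Outside \<open>{1..n}\<close> the value is \<open>undefined\<close>, as
    membership in the extensional product \<open>P\<close> requires.\<close>
  define y where "y k v = (\<lambda>j. if j \<in> J then e j (k j) else if j = n then v else undefined)"
    for k :: "nat \<Rightarrow> nat" and v
  have y: "y k v \<in> P" if "k \<in> K" "v \<in> F n" for k v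
    using that e kJ J by (auto simp: y_def PiE_iff extensional_def)
  \<comment> \<open>This is the coefficient at the multi-index \<open>k\<close> of the
    \<open>i\<close>-th summand of \<open>z\<close>. It is moved into the last slot, where
    \<open>w k\<close> collects the contributions of all summands.\<close>
  define a where "a k i = (\<Prod>j\<in>J. f j (k j) (x i j))" for k i
  define w where "w k = (\<Sum>i<m. sc (a k i) (x i n))" for k
  have xn: "x i n \<in> F n" if "i < m" for i using x[OF that] n by blast
  have w: "w k \<in> F n" for k
    unfolding w_def using xn by (intro subspace_sum subspace_scale subspace_factor n) auto
  have y_lin: "linear_map_on sc (F n) tensor_scale (\<lambda>v. elt (y k v))" if "k \<in> K" for k
  proof -
    have "(\<lambda>v. elt (y k v)) = (\<lambda>v. elt ((y k 0)(n := v)))"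
      using J(3) by (intro ext arg_cong[where f=elt]) (auto simp: y_def)
    then show ?thesis
      using elt_linear[OF y[OF that subspace_0[OF subspace_factor[OF n]]] n] by simp
  qed
  have elt_exp: "elt (x i) = (\<Sum>k\<in>K. elt (y k (sc (a k i) (x i n))))" if i: "i < m" for i
  proof -
    have "elt (x i) = (\<Sum>k\<in>K. tensor_scale (a k i) (elt (\<lambda>j. if j \<in> J then e j (k j) else x i j)))"
      unfolding K_def a_def
    proof (rule multilinear_expansion[OF vector_space_axioms vector_space_tensor_scale subspace_factor
          multilinear_elementary_tensor _ _ J(1) x[OF i]])
    qed (use e exp in auto)
    also have "\<dots> = (\<Sum>k\<in>K. elt (y k (sc (a k i) (x i n))))"
    proof (rule sum.cong[OF refl])
      fix k assume k: "k \<in> K"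
      have "(\<lambda>j. if j \<in> J then e j (k j) else x i j) = y k (x i n)"
        using x[OF i] J(4) by (auto simp: y_def fun_eq_iff PiE_iff extensional_def)
      moreover have "elt (y k (sc (a k i) (x i n))) = tensor_scale (a k i) (elt (y k (x i n)))"
        using y_lin[OF k] xn[OF i] unfolding linear_map_on_def by blast
      ultimately show "tensor_scale (a k i) (elt (\<lambda>j. if j \<in> J then e j (k j) else x i j)) =
          elt (y k (sc (a k i) (x i n)))" by simp
    qed
    finally show ?thesis .
  qed
  have "z = (\<Sum>k\<in>K. \<Sum>i<m. elt (y k (sc (a k i) (x i n))))"
    unfolding z_eq using elt_exp by (subst sum.swap) simp
  also have "\<dots> = (\<Sum>k\<in>K. elt (y k (w k)))"
  proof (rule sum.cong[OF refl])
    fix k assume "k \<in> K"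
    show "(\<Sum>i<m. elt (y k (sc (a k i) (x i n)))) = elt (y k (w k))"
      unfolding w_def
      by (rule linear_map_on_sum[OF vector_space_axioms vector_space_tensor_scale subspace_factor[OF n]
            y_lin[OF \<open>k \<in> K\<close>], symmetric])
        (use xn subspace_scale[OF subspace_factor[OF n]] in blast)
  qed
  finally have z_exp: "z = (\<Sum>k\<in>K. elt (y k (w k)))" .
  have w_le: "N n (w k) \<le> t ^ (n - 1) * eps_norm z" if k: "k \<in> K" for k
  proof -
    obtain \<phi> where \<phi>: "\<phi> \<in> dual_ball sc (F n) (N n)" "N n (w k) \<le> norm (\<phi> (w k))"
      using normed_space_on.norming_functional[OF normed[OF n] fin[OF n] w] by blast
    have \<phi>_lin: "linear_map_on sc (F n) (*) \<phi>"
      using normed_space_on.dual_ball_linear[OF normed[OF n] \<phi>(1)] .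
    \<comment> \<open>The coordinate functionals are bounded only by \<open>t\<close>, and dividing
      by \<open>t\<close> puts them into the dual ball. The \<open>n - 1\<close> divisions are the
      source of the factor \<open>t ^ (n - 1)\<close>.\<close>
    define g where "g j = (if j \<in> J then (\<lambda>u. of_real (1 / t) * f j (k j) u) else \<phi>)" for j
    have g: "g j \<in> dual_ball sc (F j) (N j)" if j: "j \<in> {1..n}" for j
    proof (cases "j \<in> J")
      case True
      show ?thesis
      proof (rule normed_space_on.bounded_functional_in_dual_ball[OF normed[OF j]])
        show "linear_map_on sc (F j) (*) (g j)"
          using lin[OF True kJ[OF k True]] True by (simp add: g_def linear_map_on_def add_divide_distrib algebra_simps)
        fix u assume "u \<in> F j"
        then show "norm (g j u) \<le> N j u"
          using f[OF True kJ[OF k True]] True t by (simp add: g_def norm_mult norm_divide pos_divide_le_eq mult.commute)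
      qed
    next
      case False
      then have "j = n" using j J(4) by blast
      then show ?thesis using False \<phi>(1) by (simp add: g_def)
    qed
    have "(\<Prod>j=1..n. g j (x i j)) = of_real (1 / t) ^ (n - 1) * \<phi> (sc (a k i) (x i n))" if i: "i < m" for i
    proof -
      have "(\<Prod>j\<in>J. g j (x i j)) = of_real (1 / t) ^ (n - 1) * a k i"
        unfolding a_def J(5)[symmetric] prod_constant[symmetric] prod.distrib[symmetric]
        by (intro prod.cong) (simp_all add: g_def)
      moreover have "\<phi> (sc (a k i) (x i n)) = a k i * \<phi> (x i n)"
        using \<phi>_lin xn[OF i] unfolding linear_map_on_def by blast
      ultimately show ?thesis
        unfolding prod_split using J(3) by (simp add: g_def)
    qed
    \<comment> \<open>Evaluated on the original representation of \<open>z\<close>, the coordinate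
      functionals chosen by \<open>k\<close> reproduce the coefficients \<open>a k i\<close>; by
      linearity of \<open>\<phi>\<close> the sum is \<open>\<phi> (w k)\<close> up to the
      scaling.\<close>
    then have "tensor_functional n g z = (\<Sum>i<m. of_real (1 / t) ^ (n - 1) * \<phi> (sc (a k i) (x i n)))"
      unfolding z_eq
      by (subst tensor_functional_sum) (use g in \<open>auto intro: normed_space_on.dual_ball_linear[OF normed]\<close>)
    also have "\<dots> = of_real (1 / t) ^ (n - 1) * \<phi> (w k)"
      unfolding w_def sum_distrib_left[symmetric]
      by (subst linear_map_on_sum[OF vector_space_axioms vector_space_field subspace_factor[OF n] \<phi>_lin])
        (use xn subspace_scale[OF subspace_factor[OF n]] in auto)
    finally have "norm (of_real (1 / t) ^ (n - 1) * \<phi> (w k)) \<le> eps_norm z"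
      using tensor_functional_le_injective[OF g z] by simp
    then have "norm (\<phi> (w k)) \<le> t ^ (n - 1) * eps_norm z"
      using t by (simp add: norm_mult norm_power norm_divide power_divide pos_divide_le_eq mult.commute)
    then show ?thesis using \<phi>(2) by simp
  qed
  have "pi_norm z \<le> (\<Sum>k\<in>K. \<Prod>j=1..n. N j (y k (w k) j))"
    using projective_norm_le[OF K(1) _ z_exp] y w by blast
  also have "\<dots> \<le> (\<Sum>k\<in>K. t ^ (n - 1) * eps_norm z)"
  proof (rule sum_mono)
    fix k assume k: "k \<in> K"
    \<comment> \<open>The basis vectors lie in the unit balls, so each of the \<open>card K\<close>
      summands is at most \<open>N n (w k)\<close>.\<close>
    have "(\<Prod>j\<in>J. N j (y k (w k) j)) \<le> 1"
    proof (rule prod_le_1)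
      fix j assume j: "j \<in> J"
      then have "j \<in> {1..n}" using J by blast
      then show "0 \<le> N j (y k (w k) j) \<and> N j (y k (w k) j) \<le> 1"
        using e[OF j kJ[OF k j]] normed_space_on.norm_nonneg[OF normed] j by (simp add: y_def)
    qed
    then have "N n (w k) * (\<Prod>j\<in>J. N j (y k (w k) j)) \<le> N n (w k)"
      using normed_space_on.norm_nonneg[OF normed[OF n] w] by (intro mult_left_le)
    then show "(\<Prod>j=1..n. N j (y k (w k) j)) \<le> t ^ (n - 1) * eps_norm z"
      unfolding prod_split using w_le[OF k] J(3) by (simp add: y_def)
  qed
  also have "\<dots> = t ^ (n - 1) * (real (\<Prod>j=1..n-1. dim (F j)) * eps_norm z)"
    by (simp add: K(2) J_def)
  finally show ?thesis .
qed

text \<open>The bases depend on \<open>t\<close>, but the two norms of \<open>z\<close> do not, so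
  \<open>t\<close> may tend to 1 from the right.\<close>

lemma projective_le_injective:
  assumes fin: "\<And>j. j \<in> {1..n} \<Longrightarrow> finite_dimensional_on sc (F j)" and z: "z \<in> T"
  shows "pi_norm z \<le> real (\<Prod>j=1..n-1. dim (F j)) * eps_norm z"
proof -
  define C where "C = real (\<Prod>j=1..n-1. dim (F j)) * eps_norm z"
  have "((\<lambda>t. t ^ (n - 1) * C) \<longlongrightarrow> 1 ^ (n - 1) * C) (at_right 1)"
    by (intro tendsto_intros)
  moreover have "\<forall>\<^sub>F t in at_right 1. pi_norm z \<le> t ^ (n - 1) * C"
    unfolding C_def using projective_le_injective_factor[OF fin z]
    by (auto intro: eventually_mono[OF eventually_at_right_less])
  ultimately have "pi_norm z \<le> 1 ^ (n - 1) * C"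
    by (rule tendsto_lowerbound) simp
  then show ?thesis by (simp add: C_def)
qed

end

section \<open>Operator norms and the Banach-Mazur distance\<close>

lemma op_norm_le:
  assumes "x0 \<in> V" "N x0 \<le> 1" "0 \<le> C" "\<And>x. x \<in> V \<Longrightarrow> M (T x) \<le> C * N x"
  shows "op_norm V N M T \<le> C"
  unfolding op_norm_def
proof (rule cSup_least)
  fix r assume "r \<in> {M (T x) |x. x \<in> V \<and> N x \<le> 1}"
  then obtain x where x: "r = M (T x)" "x \<in> V" "N x \<le> 1" by blast
  have "M (T x) \<le> C * N x" using assms(4) x by simp
  also have "\<dots> \<le> C" using x assms(3) by (simp add: mult_left_le)
  finally show "r \<le> C" using x by simp
qed (use assms in blast)

lemma op_norm_nonneg:
  assumes x0: "x0 \<in> V" "N x0 \<le> 1" "0 \<le> M (T x0)" and bdd: "bounded_op V N M T"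
    and N: "\<And>x. x \<in> V \<Longrightarrow> 0 \<le> N x"
  shows "0 \<le> op_norm V N M T"
proof -
  obtain C where C: "\<And>x. x \<in> V \<Longrightarrow> M (T x) \<le> C * N x"
    using bdd by (auto simp: bounded_op_def)
  have "bdd_above {M (T x) |x. x \<in> V \<and> N x \<le> 1}"
  proof (rule bdd_aboveI)
    fix r assume "r \<in> {M (T x) |x. x \<in> V \<and> N x \<le> 1}"
    then obtain x where x: "r = M (T x)" "x \<in> V" "N x \<le> 1" by blast
    have "M (T x) \<le> C * N x" using C x by simp
    also have "\<dots> \<le> \<bar>C\<bar> * 1" using x N[of x] by (intro mult_mono) auto
    finally show "r \<le> \<bar>C\<bar>" using x by simp
  qed
  then have "M (T x0) \<le> op_norm V N M T"
    unfolding op_norm_def using x0 by (intro cSup_upper) auto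
  then show ?thesis using x0 by simp
qed

text \<open>A real infimum lies below a member only if the set is bounded below. Here 0 is a lower
  bound because operator norms of bounded maps are nonnegative, for which each unit ball must
  contain a point.\<close>

lemma d_BM_le:
  assumes T: "normed_isomorphism s1 V N s2 W M T"
    and C: "op_norm V N M T * op_norm W M N (the_inv_into V T) \<le> C"
    and N: "\<And>x. x \<in> V \<Longrightarrow> 0 \<le> N x" "x0 \<in> V" "N x0 \<le> 1"
    and M: "\<And>y. y \<in> W \<Longrightarrow> 0 \<le> M y" "y0 \<in> W" "M y0 \<le> 1"
  shows "d_BM s1 V N s2 W M \<le> C"
proof -
  let ?S = "{op_norm V N M T * op_norm W M N (the_inv_into V T) |T. normed_isomorphism s1 V N s2 W M T}"
  have "bdd_below ?S"
  proof (rule bdd_belowI)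
    fix r assume "r \<in> ?S"
    then obtain R where R: "normed_isomorphism s1 V N s2 W M R"
      and r: "r = op_norm V N M R * op_norm W M N (the_inv_into V R)" by blast
    have bij: "bij_betw R V W" using R by (simp add: normed_isomorphism_def)
    have "R x0 \<in> W" "the_inv_into V R y0 \<in> V"
      using bij bij_betw_the_inv_into[OF bij] N M bij_betwE by blast+
    then show "0 \<le> r"
      unfolding r using R N M
      by (intro mult_nonneg_nonneg op_norm_nonneg[of x0] op_norm_nonneg[of y0])
        (auto simp: normed_isomorphism_def)
  qed
  then have "Inf ?S \<le> op_norm V N M T * op_norm W M N (the_inv_into V T)"
    using T by (intro cInf_lower) auto
  then show ?thesis using C by (simp add: d_BM_def)
qed

theorem corollary2p5:
  fixes sc :: "'k::real_or_complex_field \<Rightarrow> 'a::ab_group_add \<Rightarrow> 'a"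
    and n :: nat
    and F :: "nat \<Rightarrow> 'a set"
    and N :: "nat \<Rightarrow> 'a \<Rightarrow> real"
    and d :: "nat \<Rightarrow> nat"
  assumes "n \<ge> 1"
    and "\<And>j. j \<in> {1..n} \<Longrightarrow> normed_space_on sc (F j) (N j)"
    and "\<And>j. j \<in> {1..n} \<Longrightarrow> finite_dimensional_on sc (F j)"
    and "\<And>j. j \<in> {1..n} \<Longrightarrow> vector_space.dim sc (F j) = d j"
  shows "d_BM tensor_scale (tensor_space n sc F) (projective_norm n sc F N)
              tensor_scale (tensor_space n sc F) (injective_norm n sc F N)
         \<le> real (\<Prod>j=1..n-1. d j)"
proof -
  interpret normed_tensor_product sc n F N
    by (rule normed_tensor_product.intro[OF assms(1,2)])
  define C where "C = real (\<Prod>j=1..n-1. d j)"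
  have "(\<Prod>j=1..n-1. dim (F j)) = (\<Prod>j=1..n-1. d j)"
    using assms(4) by (intro prod.cong) auto
  then have le: "pi_norm z \<le> C * eps_norm z" if "z \<in> T" for z
    using projective_le_injective[OF assms(3) that] by (simp add: C_def)
  have C: "0 \<le> C" unfolding C_def by (rule of_nat_0_le_iff)
  \<comment> \<open>The identity is the isomorphism used; its \<open>the_inv_into\<close> is known
    to agree with it only on the tensor space.\<close>
  have inv: "the_inv_into T id z = z" if "z \<in> T" for z
    using the_inv_into_f_f[of id T z] that by simp
  have "bounded_op T pi_norm eps_norm id"
    unfolding bounded_op_def using injective_le_projective by (intro exI[of _ 1]) simp
  moreover have bdd: "bounded_op T eps_norm pi_norm (the_inv_into T id)"
    unfolding bounded_op_def using le inv by (intro exI[of _ C]) simp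
  ultimately have "normed_isomorphism tensor_scale T pi_norm tensor_scale T eps_norm id"
    by (simp add: normed_isomorphism_def linear_map_on_def)
  then show ?thesis
    unfolding C_def[symmetric]
  proof (rule d_BM_le)
    have "op_norm T pi_norm eps_norm id \<le> 1"
      using injective_le_projective by (intro op_norm_le[of 0]) (auto simp: zero_in_tensor_space norms_zero)
    moreover have "op_norm T eps_norm pi_norm (the_inv_into T id) \<le> C"
      using le inv C by (intro op_norm_le[of 0]) (auto simp: zero_in_tensor_space norms_zero)
    \<comment> \<open>Nonnegativity of the second operator norm is what allows the bounds 1 and
      \<open>C\<close> to be multiplied.\<close>
    moreover have "0 \<le> op_norm T eps_norm pi_norm (the_inv_into T id)"
      using inv injective_norm_nonneg bdd
      by (intro op_norm_nonneg[of 0]) (auto simp: zero_in_tensor_space norms_zero)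
    ultimately show "op_norm T pi_norm eps_norm id * op_norm T eps_norm pi_norm (the_inv_into T id) \<le> C"
      using mult_mono[of "op_norm T pi_norm eps_norm id" 1] by fastforce
  qed (use projective_norm_nonneg injective_norm_nonneg zero_in_tensor_space norms_zero in auto)
qed

end
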